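(* Let $T$ be a self-similar interval exchange map with associated substitution $\sigma$ and matrix $M$. Assume that $M$ has an eigenvalue $\beta$ with $|\beta|>1$ such that $\beta_0=\beta/|\beta|$ is not a root of unity, and that there exists an eigenvector $\Gamma$ of $M$ for $\beta$ such that $T$ has the unique representation property for $\beta$ and $\Gamma$. If $\gamma=(\gamma_a)_{a\in\mathcal A}$ is a good eigenvector, then no affine extension of $T$ with slope vector $\exp(-\mathrm{Re}(\gamma))=(\exp(-\mathrm{Re}(\gamma_a)))_{a\in\mathcal A}$ is conjugate to $T$.
   Context: **Self-similar i.e.m. and substitution.** Let $I=[0,1)$ and $\mathcal A$ a finite alphabet. An interval exchange map (i.e.m.) is a bijection $T\colon I\to I$ such that, for a partition $(I_a)_{a\in\mathcal A}$ of $I$ into (left-closed, right-open) intervals and a vector $\delta\in\mathbb R^{\mathcal A}$, $T(t)=t+\delta_a$ for $t\in I_a$. $T$ is self-similar (on $[0,\alpha)$, $0<\alpha<1$) if its first return map to $[0,\alpha)$ equals $T$ up to rescaling; it exchanges the intervals $I^{(1)}_a=\alpha I_a$, and $r_a$ is the first return time of $I_a^{(1)}$ to $[0,\alpha)$. The associated substitution $\sigma\colon\mathcal A\to\mathcal A^*\setminus\{\varepsilon\}$ ($\mathcal A^*$: finite words, $\varepsilon$: empty word) is given by $\sigma(a)=w_0\dots w_{r_a-1}$ where $T^m(I^{(1)}_a)\subseteq I_{w_m}$ for $0\le m\le r_a-1$ (it is part of the setting that this makes sense). $T$ is minimal and $\sigma$ is primitive. $M$ is the $\mathcal A\times\mathcal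 A$ matrix with $M_{a,b}$ = number of occurrences of $b$ in $\sigma(a)$. **Affine extensions.** An affine i.e.m. is a bijection $f\colon I\to I$ that is affine with positive slope on each of finitely many intervals, indexed by $\mathcal A$, partitioning $I$; its slopes $\ell=(\ell_a)_{a\in\mathcal A}$ form its slope vector. $f$ is an affine extension of $T$ (is semi-conjugate to $T$) with slope vector $\ell$ if there is a continuous, surjective, non-decreasing map $h\colon I\to I$ with $h\circ f=T\circ h$, where $f$ has slope $\ell_a$ on $h^{-1}(I_a)$ for each $a\in\mathcal A$. It is conjugate to $T$ if such an $h$ is injective. **Fractals.** For $w=w_0\dots w_{n-1}\in\mathcal A^*$ put $\Gamma(w)=\Gamma_{w_0}+\dots+\Gamma_{w_{n-1}}$. Let $\bar{\mathcal A}_a=\{(p,c,s)\in\mathcal A^*\times\mathcal A\times\mathcal A^*:\sigma(a)=pcs\}$ and $\bar{\mathcal A}=\bigcup_a\bar{\mathcal A}_a$ (labels). Let $\mathcal S_a$ be the set of sequences $x=(p^x_m,c^x_m,s^x_m)_{m\ge1}\in\bar{\mathcal A}^{\mathbb N}$ with $(p^x_1,c^x_1,s^x_1)\in\bar{\mathcal A}_a$ and $(p^x_{m+1},c^x_{m+1},s^x_{m+1})\in\bar{\mathcal A}_{c^x_m}$ for $m\ge1$; let $\mathcal S_{a,(p,c,s)}$ be those with first coordinate $(p,c,s)$. Put $z_a(x)=\sum_{m\ge1}\beta^{-m}\Gamma(p^x_m)$, $F_a=z_a(\mathcal S_a)$, $F_{a,(p,c,s)}=z_a(\mathcal S_{a,(p,c,s)})$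 (compact subsets of $\mathbb C$). For $\tau\in\mathbb S^1$ (unit circle in $\mathbb C$) let $v_a(\tau)=\min_{z\in F_a}\mathrm{Re}(\tau z)$ and $v_{a,(p,c,s)}(\tau)=\min_{z\in F_{a,(p,c,s)}}\mathrm{Re}(\tau z)$. A point $z\in F_a$ is extreme for the direction $\tau$ if $\mathrm{Re}(\tau z)=v_a(\tau)$. **Unique representation property (u.r.p.)** for $\beta$ and $\Gamma$: for every $a\in\mathcal A$ and every extreme point $z\in F_a$ (for any direction) there is a unique $x\in\mathcal S_a$ with $z_a(x)=z$. **Good eigenvectors.** $\Psi_a$ is the set of $\tau\in\mathbb S^1$ such that $v_a(\tau)=v_{a,(p,c,s)}(\tau)=v_{a,(\bar p,\bar c,\bar s)}(\tau)$ for some different labels $(p,c,s),(\bar p,\bar c,\bar s)\in\bar{\mathcal A}_a$; $\Psi=\bigcup_a\Psi_a$. $\llbracket\tau-\tau'\rrbracket$ is the natural (arc-length) distance on $\mathbb S^1$. A direction $\tau\in\mathbb S^1$ is good if for some constant $1<A<|\beta|$ and every $\xi\in\Psi$, $\liminf_{n\to\infty}A^n\llbracket\xi-\beta_0^n\tau\rrbracket=\infty$. An eigenvector $\gamma$ of $M$ for $\beta$ is good if $\gamma=z\Gamma$ with $z\in\mathbb C\setminus\{0\}$ and $z/|z|$ a good direction. *)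

theory Defs
  imports "HOL-Analysis.Analysis"
begin

section \<open>Interval exchange maps\<close>

abbreviation unit_Ico :: "real set"
  where "unit_Ico \<equiv> {0..<1}"

definition interval_partition :: "('a \<Rightarrow> real set) \<Rightarrow> bool"
  where "interval_partition J \<longleftrightarrow>
    (\<forall>a. \<exists>l r. l < r \<and> J a = {l..<r}) \<and> disjoint_family J \<and> (\<Union>a. J a) = unit_Ico"

definition iem :: "(real \<Rightarrow> real) \<Rightarrow> ('a::finite \<Rightarrow> real set) \<Rightarrow> bool"
  where "iem T J \<longleftrightarrow>
    bij_betw T unit_Ico unit_Ico \<and> interval_partition J \<and>
    (\<exists>\<delta> :: real^'a. \<forall>a. \<forall>t\<in>J a. T t = t + \<delta> $ a)"

text \<open>Two-sided orbit of a point under a bijection of \<open>[0,1)\<close>; the second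
  disjunct collects the points \<open>T\<^sup>-\<^sup>n t\<close>.\<close>

definition full_orbit :: "(real \<Rightarrow> real) \<Rightarrow> real \<Rightarrow> real set"
  where "full_orbit T t = {s \<in> unit_Ico. \<exists>n. s = (T ^^ n) t \<or> (T ^^ n) s = t}"

definition minimal_map :: "(real \<Rightarrow> real) \<Rightarrow> bool"
  where "minimal_map T \<longleftrightarrow> (\<forall>t\<in>unit_Ico. unit_Ico \<subseteq> closure (full_orbit T t))"

definition first_return_time :: "(real \<Rightarrow> real) \<Rightarrow> real set \<Rightarrow> real \<Rightarrow> nat"
  where "first_return_time T S t = (LEAST n. 0 < n \<and> (T ^^ n) t \<in> S)"

definition first_return_map :: "(real \<Rightarrow> real) \<Rightarrow> real set \<Rightarrow> real \<Rightarrow> real"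
  where "first_return_map T S t = (T ^^ first_return_time T S t) t"

definition self_similar :: "(real \<Rightarrow> real) \<Rightarrow> real \<Rightarrow> bool"
  where "self_similar T \<alpha> \<longleftrightarrow>
    0 < \<alpha> \<and> \<alpha> < 1 \<and>
    (\<forall>t\<in>{0..<\<alpha>}. (\<exists>n>0. (T ^^ n) t \<in> {0..<\<alpha>}) \<and>
       first_return_map T {0..<\<alpha>} t = \<alpha> * T (t / \<alpha>))"


section \<open>The associated substitution and its matrix\<close>

text \<open>The length of \<open>\<sigma> a\<close> is the return time \<open>r\<^sub>a\<close>, common to all points of \<open>\<alpha> I\<^sub>a\<close>.
  For an i.e.m. that is self-similar on \<open>[0,\<alpha>)\<close> at most one \<open>\<sigma>\<close> satisfies this.\<close>

definition associated_substitution ::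
    "(real \<Rightarrow> real) \<Rightarrow> ('a \<Rightarrow> real set) \<Rightarrow> real \<Rightarrow> ('a \<Rightarrow> 'a list) \<Rightarrow> bool"
  where "associated_substitution T J \<alpha> \<sigma> \<longleftrightarrow>
    (\<forall>a. \<sigma> a \<noteq> [] \<and>
      (\<forall>t\<in>(*) \<alpha> ` J a. first_return_time T {0..<\<alpha>} t = length (\<sigma> a)) \<and>
      (\<forall>m<length (\<sigma> a). (T ^^ m) ` ((*) \<alpha> ` J a) \<subseteq> J (\<sigma> a ! m)))"

definition subst_word :: "('a \<Rightarrow> 'a list) \<Rightarrow> 'a list \<Rightarrow> 'a list"
  where "subst_word \<sigma> w = concat (map \<sigma> w)"

definition primitive_subst :: "('a \<Rightarrow> 'a list) \<Rightarrow> bool"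
  where "primitive_subst \<sigma> \<longleftrightarrow> (\<exists>n>0. \<forall>a b. b \<in> set ((subst_word \<sigma> ^^ n) [a]))"

definition subst_matrix :: "('a::finite \<Rightarrow> 'a list) \<Rightarrow> complex^'a^'a"
  where "subst_matrix \<sigma> = (\<chi> a b. of_nat (count_list (\<sigma> a) b))"

definition eigenvector_for :: "complex^'a^'a \<Rightarrow> complex \<Rightarrow> complex^'a::finite \<Rightarrow> bool"
  where "eigenvector_for M \<beta> v \<longleftrightarrow> v \<noteq> 0 \<and> M *v v = \<beta> *s v"


section \<open>Affine extensions\<close>

definition has_slope_on :: "(real \<Rightarrow> real) \<Rightarrow> real \<Rightarrow> real set \<Rightarrow> bool"
  where "has_slope_on f l S \<longleftrightarrow> (\<exists>d. \<forall>t\<in>S. f t = l * t + d)"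

definition affine_iem :: "(real \<Rightarrow> real) \<Rightarrow> real^'a::finite \<Rightarrow> bool"
  where "affine_iem f l \<longleftrightarrow>
    bij_betw f unit_Ico unit_Ico \<and> (\<forall>a. 0 < l $ a) \<and>
    (\<exists>K. interval_partition K \<and> (\<forall>a. has_slope_on f (l $ a) (K a)))"

definition affine_semiconjugacy ::
    "(real \<Rightarrow> real) \<Rightarrow> ('a \<Rightarrow> real set) \<Rightarrow> real^'a::finite \<Rightarrow> (real \<Rightarrow> real) \<Rightarrow> (real \<Rightarrow> real) \<Rightarrow> bool"
  where "affine_semiconjugacy T J l f h \<longleftrightarrow>
    continuous_on unit_Ico h \<and> h ` unit_Ico = unit_Ico \<and> mono_on unit_Ico h \<and>
    (\<forall>t\<in>unit_Ico. h (f t) = T (h t)) \<and>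
    (\<forall>a. has_slope_on f (l $ a) {t \<in> unit_Ico. h t \<in> J a})"

definition affine_extension ::
    "(real \<Rightarrow> real) \<Rightarrow> ('a \<Rightarrow> real set) \<Rightarrow> real^'a::finite \<Rightarrow> (real \<Rightarrow> real) \<Rightarrow> bool"
  where "affine_extension T J l f \<longleftrightarrow> affine_iem f l \<and> (\<exists>h. affine_semiconjugacy T J l f h)"

definition affine_conjugate ::
    "(real \<Rightarrow> real) \<Rightarrow> ('a \<Rightarrow> real set) \<Rightarrow> real^'a::finite \<Rightarrow> (real \<Rightarrow> real) \<Rightarrow> bool"
  where "affine_conjugate T J l f \<longleftrightarrow>
    (\<exists>h. affine_semiconjugacy T J l f h \<and> inj_on h unit_Ico)"


section \<open>Fractals\<close>

type_synonym 'a label = "'a list \<times> 'a \<times> 'a list"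

definition labels :: "('a \<Rightarrow> 'a list) \<Rightarrow> 'a \<Rightarrow> 'a label set"
  where "labels \<sigma> a = {(p, c, s). \<sigma> a = p @ [c] @ s}"

text \<open>Sequences of labels are indexed from \<open>0\<close>: the coordinate \<open>m \<ge> 1\<close> of the usual
  notation is \<open>x (m - 1)\<close> here, whence the exponent \<open>Suc m\<close> in \<open>frac_point\<close>.\<close>

definition label_seqs :: "('a \<Rightarrow> 'a list) \<Rightarrow> 'a \<Rightarrow> (nat \<Rightarrow> 'a label) set"
  where "label_seqs \<sigma> a =
    {x. x 0 \<in> labels \<sigma> a \<and> (\<forall>m. x (Suc m) \<in> labels \<sigma> (fst (snd (x m))))}"

definition label_seqs_from :: "('a \<Rightarrow> 'a list) \<Rightarrow> 'a \<Rightarrow> 'a label \<Rightarrow> (nat \<Rightarrow> 'a label) set"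
  where "label_seqs_from \<sigma> a e = {x \<in> label_seqs \<sigma> a. x 0 = e}"

definition word_value :: "complex^'a::finite \<Rightarrow> 'a list \<Rightarrow> complex"
  where "word_value \<Gamma> w = sum_list (map (\<lambda>b. \<Gamma> $ b) w)"

definition frac_point :: "complex \<Rightarrow> complex^'a::finite \<Rightarrow> (nat \<Rightarrow> 'a label) \<Rightarrow> complex"
  where "frac_point \<beta> \<Gamma> x = (\<Sum>m. word_value \<Gamma> (fst (x m)) / \<beta> ^ Suc m)"

definition fractal :: "('a \<Rightarrow> 'a list) \<Rightarrow> complex \<Rightarrow> complex^'a::finite \<Rightarrow> 'a \<Rightarrow> complex set"
  where "fractal \<sigma> \<beta> \<Gamma> a = frac_point \<beta> \<Gamma> ` label_seqs \<sigma> a"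

definition subfractal ::
    "('a \<Rightarrow> 'a list) \<Rightarrow> complex \<Rightarrow> complex^'a::finite \<Rightarrow> 'a \<Rightarrow> 'a label \<Rightarrow> complex set"
  where "subfractal \<sigma> \<beta> \<Gamma> a e = frac_point \<beta> \<Gamma> ` label_seqs_from \<sigma> a e"

text \<open>On the nonempty compact sets it is used for, the infimum is a minimum.\<close>

definition support_min :: "complex set \<Rightarrow> complex \<Rightarrow> real"
  where "support_min F \<tau> = (INF z\<in>F. Re (\<tau> * z))"

definition extreme_for :: "complex set \<Rightarrow> complex \<Rightarrow> complex \<Rightarrow> bool"
  where "extreme_for F \<tau> z \<longleftrightarrow> z \<in> F \<and> Re (\<tau> * z) = support_min F \<tau>"

definition unique_representation ::
    "('a \<Rightarrow> 'a list) \<Rightarrow> complex \<Rightarrow> complex^'a::finite \<Rightarrow> bool"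
  where "unique_representation \<sigma> \<beta> \<Gamma> \<longleftrightarrow>
    (\<forall>a z. (\<exists>\<tau>\<in>sphere 0 1. extreme_for (fractal \<sigma> \<beta> \<Gamma> a) \<tau> z) \<longrightarrow>
      (\<exists>!x. x \<in> label_seqs \<sigma> a \<and> frac_point \<beta> \<Gamma> x = z))"


section \<open>Good eigenvectors\<close>

definition tie_dirs_at :: "('a \<Rightarrow> 'a list) \<Rightarrow> complex \<Rightarrow> complex^'a::finite \<Rightarrow> 'a \<Rightarrow> complex set"
  where "tie_dirs_at \<sigma> \<beta> \<Gamma> a =
    {\<tau> \<in> sphere 0 1. \<exists>e\<in>labels \<sigma> a. \<exists>e'\<in>labels \<sigma> a. e \<noteq> e' \<and>
       support_min (fractal \<sigma> \<beta> \<Gamma> a) \<tau> = support_min (subfractal \<sigma> \<beta> \<Gamma> a e) \<tau> \<and>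
       support_min (fractal \<sigma> \<beta> \<Gamma> a) \<tau> = support_min (subfractal \<sigma> \<beta> \<Gamma> a e') \<tau>}"

definition tie_dirs :: "('a \<Rightarrow> 'a list) \<Rightarrow> complex \<Rightarrow> complex^'a::finite \<Rightarrow> complex set"
  where "tie_dirs \<sigma> \<beta> \<Gamma> = (\<Union>a. tie_dirs_at \<sigma> \<beta> \<Gamma> a)"

text \<open>Arc length on the unit circle; \<open>Arg\<close> takes values in \<open>(-\<pi>, \<pi>]\<close>.\<close>

definition arc_dist :: "complex \<Rightarrow> complex \<Rightarrow> real"
  where "arc_dist \<tau> \<tau>' = \<bar>Arg (\<tau> / \<tau>')\<bar>"

definition unit_part :: "complex \<Rightarrow> complex"
  where "unit_part z = z / of_real (cmod z)"

definition good_direction ::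
    "('a \<Rightarrow> 'a list) \<Rightarrow> complex \<Rightarrow> complex^'a::finite \<Rightarrow> complex \<Rightarrow> bool"
  where "good_direction \<sigma> \<beta> \<Gamma> \<tau> \<longleftrightarrow>
    \<tau> \<in> sphere 0 1 \<and>
    (\<exists>A. 1 < A \<and> A < cmod \<beta> \<and>
      (\<forall>\<xi>\<in>tie_dirs \<sigma> \<beta> \<Gamma>.
         liminf (\<lambda>n. ereal (A ^ n * arc_dist \<xi> (unit_part \<beta> ^ n * \<tau>))) = \<infinity>))"

definition good_eigenvector ::
    "('a \<Rightarrow> 'a list) \<Rightarrow> complex \<Rightarrow> complex^'a::finite \<Rightarrow> complex^'a \<Rightarrow> bool"
  where "good_eigenvector \<sigma> \<beta> \<Gamma> \<gamma> \<longleftrightarrow>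
    eigenvector_for (subst_matrix \<sigma>) \<beta> \<gamma> \<and>
    (\<exists>z. z \<noteq> 0 \<and> \<gamma> = z *s \<Gamma> \<and> good_direction \<sigma> \<beta> \<Gamma> (unit_part z))"

end

theory Submission
  imports Defs
begin

text \<open>Suppose that an affine extension \<open>f\<close> of \<open>T\<close> with slopes \<open>exp (- Re \<gamma>\<^sub>a)\<close> is conjugate to \<open>T\<close> by
  a homeomorphism \<open>h\<close>. By self-similarity, the \<open>n\<close>-th renormalisation cuts \<open>[0,1)\<close> into towers:
  the \<open>m\<close>-th floor over the letter \<open>a\<close> is \<open>T\<^sup>m (\<alpha>\<^sup>n I\<^sub>a)\<close>, for \<open>m < |\<sigma>\<^sup>n(a)|\<close>. Its preimage under
  \<open>h\<close> is an interval whose length is \<open>exp (- S\<^sub>m)\<close> times that of the bottom floor, where \<open>S\<^sub>m\<close>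
  is the real part of the sum of \<open>\<gamma>\<close> over the first \<open>m\<close> letters of \<open>\<sigma>\<^sup>n(a)\<close>. Two facts
  collide. Since \<open>h\<close> has a uniformly continuous inverse, the lengths of all floors tend to \<open>0\<close>
  uniformly as \<open>n\<close> grows, while their total stays \<open>1\<close>. But if
  \<open>\<Sum>\<^sub>m exp (- S\<^sub>m)\<close> is at most a constant multiple of its largest term, uniformly in \<open>n\<close> and
  \<open>a\<close>, then the total length is at most a constant multiple of the longest floor, hence
  tends to \<open>0\<close>. This contradiction is \<open>no_conjugate_of_bounded_sums\<close>.

  That one term dominates the sum is the content of \<open>renormalised_sums\<close>, and this is where the
  fractals enter. Writing a prefix of \<open>\<sigma>\<^sup>n(a)\<close> along its path of labels shows that its \<open>\<gamma>\<close>-value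
  is, up to a bounded error, \<open>z \<beta>\<^sup>n\<close> times a point of the fractal of \<open>a\<close>, where \<open>\<gamma> = z \<Gamma>\<close>.
  So the minimum of \<open>S\<^sub>m\<close> is, up to a bounded error, the support value
  \<open>V n a = min {Re (\<beta>\<^sup>n z y) | y \<in> F\<^sub>a}\<close>. The self-affine structure of the fractals turns into
  the recursion \<open>V (n+1) a = min\<^sub>i (Re (\<beta>\<^sup>n \<gamma>(take i (\<sigma> a))) + V n (\<sigma> a ! i))\<close>, and the
  sums of exponentials obey the same recursion with a sum in place of the minimum. If in each step the
  non-optimal labels lose by at least \<open>g n\<close>, the normalised sums grow by a factor of at most
  \<open>1 + R exp (- g n)\<close>, so they stay bounded as soon as \<open>\<Sum> exp (- g n)\<close> converges
  (\<open>prefix_weight_bound\<close>).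

  It remains to see that the loss grows exponentially. In the direction \<open>\<tau>\<^sub>n = \<beta>\<^sub>0\<^sup>n z/|z|\<close> it is \<open>|z| |\<beta>|\<^sup>n\<close>
  times the gap between the support values of two subfractals. By the
  unique representation property, different subfractals share no extreme point of \<open>F\<^sub>a\<close>. Hence
  at a direction \<open>\<xi>\<close> where several of them tie, their extreme points are distinct points of one
  supporting line, and turning the line by an angle \<open>\<theta>\<close> separates the winner from the others by
  at least \<open>\<kappa> \<bar>\<theta>\<bar>\<close> (\<open>local_gap\<close>); at other directions the gap is locally
  bounded below. By compactness of the circle and the goodness of \<open>z/|z|\<close>, the gap at \<open>\<tau>\<^sub>n\<close> is
  eventually at least \<open>\<kappa> A\<^sup>-\<^sup>n\<close> with \<open>A < |\<beta>|\<close> (\<open>eventually_label_gap\<close>), so the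
  loss is at least a constant times \<open>(|\<beta>|/A)\<^sup>n\<close>.\<close>

section \<open>Words and prefix sums\<close>

lemma word_value_Nil [simp]: "word_value \<Gamma> [] = 0"
  by (simp add: word_value_def)

lemma word_value_append [simp]: "word_value \<Gamma> (u @ v) = word_value \<Gamma> u + word_value \<Gamma> v"
  by (simp add: word_value_def)

lemma word_value_single [simp]: "word_value \<Gamma> [a] = \<Gamma> $ a"
  by (simp add: word_value_def)

lemma word_value_scale: "word_value (z *s \<Gamma>) w = z * word_value \<Gamma> w"
  by (induction w) (simp_all add: word_value_def algebra_simps)

lemma word_value_count:
  fixes \<Gamma> :: "complex^'a::finite"
  shows "word_value \<Gamma> w = (\<Sum>b\<in>UNIV. of_nat (count_list w b) * \<Gamma> $ b)"
proof (induction w)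
  case (Cons a w)
  have "word_value \<Gamma> (a # w) = \<Gamma> $ a + word_value \<Gamma> w"
    by (simp add: word_value_def)
  also have "\<Gamma> $ a = (\<Sum>b\<in>UNIV. (if b = a then \<Gamma> $ b else 0))"
    by simp
  also have "\<dots> + word_value \<Gamma> w =
      (\<Sum>b\<in>UNIV. (if b = a then \<Gamma> $ b else 0) + of_nat (count_list w b) * \<Gamma> $ b)"
    unfolding Cons.IH sum.distrib ..
  also have "\<dots> = (\<Sum>b\<in>UNIV. of_nat (count_list (a # w) b) * \<Gamma> $ b)"
    by (rule sum.cong) (auto simp: algebra_simps)
  finally show ?case .
qed simp

lemma subst_word_append [simp]: "subst_word \<sigma> (u @ v) = subst_word \<sigma> u @ subst_word \<sigma> v"
  by (simp add: subst_word_def)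

lemma subst_word_power_append [simp]:
  "(subst_word \<sigma> ^^ n) (u @ v) = (subst_word \<sigma> ^^ n) u @ (subst_word \<sigma> ^^ n) v"
  by (induction n) simp_all

lemma subst_word_power_Nil [simp]: "(subst_word \<sigma> ^^ n) [] = []"
  by (induction n) (simp_all add: subst_word_def)

lemma subst_word_power_Suc_single:
  "(subst_word \<sigma> ^^ Suc n) [a] = (subst_word \<sigma> ^^ n) (\<sigma> a)"
  by (simp add: funpow_swap1 subst_word_def)

lemma word_value_subst_word:
  assumes "eigenvector_for (subst_matrix \<sigma>) \<beta> \<gamma>"
  shows "word_value \<gamma> (subst_word \<sigma> w) = \<beta> * word_value \<gamma> w"
proof (induction w)
  case (Cons a w)
  have "word_value \<gamma> (\<sigma> a) = (subst_matrix \<sigma> *v \<gamma>) $ a"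
    by (simp add: word_value_count matrix_vector_mult_def subst_matrix_def)
  also have "\<dots> = \<beta> * \<gamma> $ a"
    using assms by (simp add: eigenvector_for_def)
  finally have "word_value \<gamma> (\<sigma> a) = \<beta> * \<gamma> $ a" .
  with Cons show ?case
    by (simp add: subst_word_def word_value_def algebra_simps)
qed (simp add: subst_word_def)

lemma word_value_subst_word_power:
  assumes "eigenvector_for (subst_matrix \<sigma>) \<beta> \<gamma>"
  shows "word_value \<gamma> ((subst_word \<sigma> ^^ n) w) = \<beta> ^ n * word_value \<gamma> w"
  by (induction n) (simp_all add: word_value_subst_word[OF assms])

text \<open>For the word of a tower this is the total length of the tower relative to the length of its
  bottom floor. The empty prefix is counted and the whole word is not: there is one term per floor.\<close>

definition prefix_weight :: "complex^'a::finite \<Rightarrow> 'a list \<Rightarrow> real"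
  where "prefix_weight \<gamma> w = (\<Sum>m<length w. exp (- Re (word_value \<gamma> (take m w))))"

lemma prefix_weight_nonneg: "0 \<le> prefix_weight \<gamma> w"
  unfolding prefix_weight_def by (intro sum_nonneg) simp

lemma prefix_weight_append:
  "prefix_weight \<gamma> (u @ v) = prefix_weight \<gamma> u + exp (- Re (word_value \<gamma> u)) * prefix_weight \<gamma> v"
proof -
  let ?g = "\<lambda>w m. exp (- Re (word_value \<gamma> (take m w)))"
  have "prefix_weight \<gamma> (u @ v) = (\<Sum>m<length u. ?g (u @ v) m) + (\<Sum>m<length v. ?g (u @ v) (length u + m))"
  proof -
    have "{..<length (u @ v)} = {..<length u} \<union> (+) (length u) ` {..<length v}"
    proof safe
      fix m assume "m < length (u @ v)" "m \<notin> (+) (length u) ` {..<length v}"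
      moreover have "m \<in> (+) (length u) ` {..<length v}" if "length u \<le> m" "m < length (u @ v)"
        using that by (intro image_eqI[where x = "m - length u"]) auto
      ultimately show "m < length u"
        using leI by blast
    qed auto
    hence "prefix_weight \<gamma> (u @ v) = (\<Sum>m<length u. ?g (u @ v) m) + (\<Sum>m\<in>(+) (length u) ` {..<length v}. ?g (u @ v) m)"
      unfolding prefix_weight_def by (simp only:) (subst sum.union_disjoint, auto)
    thus ?thesis
      by (simp add: sum.reindex)
  qed
  also have "\<dots> = prefix_weight \<gamma> u + exp (- Re (word_value \<gamma> u)) * prefix_weight \<gamma> v"
    unfolding prefix_weight_def sum_distrib_left
    by (intro arg_cong2[where f = "(+)"] sum.cong) (simp_all flip: exp_add)
  finally show ?thesis .
qed

text \<open>A proper prefix of \<open>\<sigma>\<^sup>n(w)\<close> is \<open>\<sigma>\<^sup>n(take i w)\<close> followed by a proper prefix of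
  \<open>\<sigma>\<^sup>n(w ! i)\<close> for exactly one \<open>i\<close>; the eigenvector equation turns the value of the first
  part into \<open>\<beta>\<^sup>n \<gamma>(take i w)\<close>.\<close>

lemma prefix_weight_subst_word_power:
  assumes "eigenvector_for (subst_matrix \<sigma>) \<beta> \<gamma>"
  shows "prefix_weight \<gamma> ((subst_word \<sigma> ^^ n) w) =
    (\<Sum>i<length w. exp (- Re (\<beta> ^ n * word_value \<gamma> (take i w))) *
       prefix_weight \<gamma> ((subst_word \<sigma> ^^ n) [w ! i]))"
proof (induction w rule: rev_induct)
  case Nil
  show ?case by (simp add: prefix_weight_def)
next
  case (snoc a w)
  show ?case
    by (simp add: prefix_weight_append snoc word_value_subst_word_power[OF assms] nth_append)
qed

section \<open>Fractals are compact\<close>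

lemma labels_conv_image:
  "labels \<sigma> a = (\<lambda>i. (take i (\<sigma> a), \<sigma> a ! i, drop (Suc i) (\<sigma> a))) ` {..<length (\<sigma> a)}"
proof safe
  fix p c s assume "(p, c, s) \<in> labels \<sigma> a"
  thus "(p, c, s) \<in> (\<lambda>i. (take i (\<sigma> a), \<sigma> a ! i, drop (Suc i) (\<sigma> a))) ` {..<length (\<sigma> a)}"
    by (intro image_eqI[where x = "length p"]) (auto simp: labels_def)
next
  fix i assume "i < length (\<sigma> a)"
  thus "(take i (\<sigma> a), \<sigma> a ! i, drop (Suc i) (\<sigma> a)) \<in> labels \<sigma> a"
    by (simp add: labels_def id_take_nth_drop[symmetric])
qed

lemma finite_labels: "finite (labels \<sigma> a)"
  by (simp add: labels_conv_image)

lemma labels_nonempty: "\<sigma> a \<noteq> [] \<Longrightarrow> labels \<sigma> a \<noteq> {}"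
  by (auto simp: labels_conv_image lessThan_empty_iff)

lemma label_seqs_Suc_shift:
  assumes "x \<in> label_seqs \<sigma> a"
  shows "(\<lambda>m. x (Suc m)) \<in> label_seqs \<sigma> (fst (snd (x 0)))"
  using assms by (auto simp: label_seqs_def)

lemma label_seqs_Cons:
  assumes "(p, c, s) \<in> labels \<sigma> a" "x \<in> label_seqs \<sigma> c"
  shows "case_nat (p, c, s) x \<in> label_seqs \<sigma> a"
  using assms by (auto simp: label_seqs_def split: nat.split)

lemma label_seqs_nonempty:
  assumes "\<forall>a. \<sigma> a \<noteq> []"
  shows "label_seqs \<sigma> a \<noteq> {}"
proof -
  obtain E where E: "\<And>a. E a \<in> labels \<sigma> a"
    using labels_nonempty[of \<sigma>] assms unfolding ex_in_conv[symmetric] by metis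
  define x where "x m = ((\<lambda>e. E (fst (snd e))) ^^ m) (E a)" for m
  have "x \<in> label_seqs \<sigma> a"
    using E by (simp add: label_seqs_def x_def)
  thus ?thesis by blast
qed

lemma label_value_bound:
  fixes \<Gamma> :: "complex^'a::finite"
  obtains G where "0 \<le> G" "\<And>a e. e \<in> labels \<sigma> a \<Longrightarrow> cmod (word_value \<Gamma> (fst e)) \<le> G"
proof -
  let ?S = "\<Union>a. (\<lambda>e. cmod (word_value \<Gamma> (fst e))) ` labels \<sigma> a"
  have "finite ?S" by (auto simp: finite_labels)
  then obtain G where "\<forall>y\<in>?S. y \<le> G"
    using bdd_above_finite unfolding bdd_above_def by blast
  thus ?thesis
    by (intro that[of "max G 0"]) (auto simp: le_max_iff_disj)
qed

lemma label_seqs_coord: "x \<in> label_seqs \<sigma> a \<Longrightarrow> \<exists>b. x m \<in> labels \<sigma> b"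
  by (cases m) (auto simp: label_seqs_def)

lemma summable_geometric_shifted:
  assumes "cmod \<beta> > 1"
  shows "summable (\<lambda>m. G / cmod \<beta> ^ Suc m)"
proof -
  have "summable (\<lambda>m. G / cmod \<beta> * (1 / cmod \<beta>) ^ m)"
    using assms by (intro summable_mult summable_geometric) (simp add: divide_less_eq)
  thus ?thesis by (simp add: power_divide)
qed

lemma frac_point_term_bound:
  assumes "\<And>a e. e \<in> labels \<sigma> a \<Longrightarrow> cmod (word_value \<Gamma> (fst e)) \<le> G" "x \<in> label_seqs \<sigma> a"
  shows "norm (word_value \<Gamma> (fst (x m)) / \<beta> ^ Suc m) \<le> G / cmod \<beta> ^ Suc m"
proof -
  have "cmod (word_value \<Gamma> (fst (x m))) \<le> G"
    using assms(1) label_seqs_coord[OF assms(2), of m] by blast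
  thus ?thesis
    unfolding norm_divide norm_power by (intro divide_right_mono) auto
qed

lemma summable_frac_point:
  fixes \<Gamma> :: "complex^'a::finite"
  assumes "cmod \<beta> > 1" "x \<in> label_seqs \<sigma> a"
  shows "summable (\<lambda>m. word_value \<Gamma> (fst (x m)) / \<beta> ^ Suc m)"
proof -
  obtain G where "\<And>a e. e \<in> labels \<sigma> a \<Longrightarrow> cmod (word_value \<Gamma> (fst e)) \<le> G"
    using label_value_bound[of \<sigma> \<Gamma>] by metis
  hence "norm (word_value \<Gamma> (fst (x m)) / \<beta> ^ Suc m) \<le> G / cmod \<beta> ^ Suc m" for m
    using assms(2) by (rule frac_point_term_bound)
  thus ?thesis
    by (intro summable_comparison_test'[OF summable_geometric_shifted[OF assms(1)]])
qed

lemma bounded_fractals: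
  fixes \<Gamma> :: "complex^'a::finite"
  assumes "cmod \<beta> > 1"
  shows "\<exists>M. \<forall>a. \<forall>z\<in>fractal \<sigma> \<beta> \<Gamma> a. cmod z \<le> M"
proof -
  obtain G where G: "\<And>a e. e \<in> labels \<sigma> a \<Longrightarrow> cmod (word_value \<Gamma> (fst e)) \<le> G"
    using label_value_bound[of \<sigma> \<Gamma>] by metis
  have "cmod (frac_point \<beta> \<Gamma> x) \<le> (\<Sum>m. G / cmod \<beta> ^ Suc m)" if "x \<in> label_seqs \<sigma> a" for a x
    unfolding frac_point_def
    by (rule norm_suminf_le[OF frac_point_term_bound[OF G that] summable_geometric_shifted[OF assms]])
  thus ?thesis unfolding fractal_def by blast
qed

lemma frac_point_shift:
  fixes \<Gamma> :: "complex^'a::finite"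
  assumes "cmod \<beta> > 1" "x \<in> label_seqs \<sigma> a"
  shows "frac_point \<beta> \<Gamma> x = (word_value \<Gamma> (fst (x 0)) + frac_point \<beta> \<Gamma> (\<lambda>m. x (Suc m))) / \<beta>"
proof -
  let ?t = "\<lambda>m. word_value \<Gamma> (fst (x m)) / \<beta> ^ Suc m"
  have "frac_point \<beta> \<Gamma> x = (\<Sum>m. ?t (Suc m)) + ?t 0"
    unfolding frac_point_def using suminf_split_head[OF summable_frac_point[OF assms]] by simp
  also have "(\<Sum>m. ?t (Suc m)) = (\<Sum>m. word_value \<Gamma> (fst (x (Suc m))) / \<beta> ^ Suc m / \<beta>)"
    by (simp add: field_simps)
  also have "\<dots> = frac_point \<beta> \<Gamma> (\<lambda>m. x (Suc m)) / \<beta>"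
    unfolding frac_point_def
    by (rule suminf_divide) (rule summable_frac_point[OF assms(1) label_seqs_Suc_shift[OF assms(2)]])
  finally show ?thesis by (simp add: add_divide_distrib)
qed

text \<open>Deleting the first label of a sequence multiplies the rest of its series by \<open>\<beta>\<close>, so the
  fractals solve a graph-directed system of contractions.\<close>

lemma subfractal_eq_image:
  fixes \<Gamma> :: "complex^'a::finite"
  assumes \<beta>: "cmod \<beta> > 1" and e: "(p, c, s) \<in> labels \<sigma> a"
  shows "subfractal \<sigma> \<beta> \<Gamma> a (p, c, s) = (\<lambda>z. (word_value \<Gamma> p + z) / \<beta>) ` fractal \<sigma> \<beta> \<Gamma> c"
proof safe
  fix z assume "z \<in> subfractal \<sigma> \<beta> \<Gamma> a (p, c, s)"
  then obtain x where "x \<in> label_seqs \<sigma> a" "x 0 = (p, c, s)" "z = frac_point \<beta> \<Gamma> x"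
    by (auto simp: subfractal_def label_seqs_from_def)
  with frac_point_shift[OF \<beta>, of x \<sigma> a \<Gamma>] label_seqs_Suc_shift[of x \<sigma> a]
  show "z \<in> (\<lambda>z. (word_value \<Gamma> p + z) / \<beta>) ` fractal \<sigma> \<beta> \<Gamma> c"
    by (auto simp: fractal_def)
next
  fix z assume "z \<in> fractal \<sigma> \<beta> \<Gamma> c"
  then obtain x where x: "x \<in> label_seqs \<sigma> c" "z = frac_point \<beta> \<Gamma> x"
    by (auto simp: fractal_def)
  from label_seqs_Cons[OF e x(1)] frac_point_shift[OF \<beta> label_seqs_Cons[OF e x(1)], of \<Gamma>] x(2)
  show "(word_value \<Gamma> p + z) / \<beta> \<in> subfractal \<sigma> \<beta> \<Gamma> a (p, c, s)"
    unfolding subfractal_def label_seqs_from_def by (auto intro!: image_eqI[where x = "case_nat (p, c, s) x"])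
qed

lemma fractal_eq_UN_subfractal: "fractal \<sigma> \<beta> \<Gamma> a = (\<Union>e\<in>labels \<sigma> a. subfractal \<sigma> \<beta> \<Gamma> a e)"
  by (auto simp: fractal_def subfractal_def label_seqs_from_def label_seqs_def)

text \<open>The fractals form the largest bounded family that is covered by its own images:
  a point of \<open>K a\<close> can be unrolled for ever, each step producing a label and multiplying the
  remainder by \<open>\<beta>\<close>. As the remainders stay bounded, the series of the labels converges to the
  point.\<close>

lemma bounded_invariant_subset_fractal:
  fixes \<Gamma> :: "complex^'a::finite"
  assumes \<beta>: "cmod \<beta> > 1"
    and bnd: "\<And>a z. z \<in> K a \<Longrightarrow> cmod z \<le> M"
    and inv: "\<And>a z. z \<in> K a \<Longrightarrow>
      \<exists>p c s. (p, c, s) \<in> labels \<sigma> a \<and> (\<exists>y\<in>K c. z = (word_value \<Gamma> p + y) / \<beta>)"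
  shows "K a \<subseteq> fractal \<sigma> \<beta> \<Gamma> a"
proof
  fix z assume z: "z \<in> K a"
  have "\<forall>a z. \<exists>e. z \<in> K a \<longrightarrow> e \<in> labels \<sigma> a \<and> \<beta> * z - word_value \<Gamma> (fst e) \<in> K (fst (snd e))"
  proof (intro allI)
    fix a z
    show "\<exists>e. z \<in> K a \<longrightarrow> e \<in> labels \<sigma> a \<and> \<beta> * z - word_value \<Gamma> (fst e) \<in> K (fst (snd e))"
    proof (cases "z \<in> K a")
      case True
      then obtain p c s y where "(p, c, s) \<in> labels \<sigma> a" "y \<in> K c" "z = (word_value \<Gamma> p + y) / \<beta>"
        using inv by blast
      thus ?thesis using \<beta> by (intro exI[of _ "(p, c, s)"]) auto
    qed simp
  qed
  then obtain E where E: "\<And>a z. z \<in> K a \<Longrightarrow> E a z \<in> labels \<sigma> a"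
      "\<And>a z. z \<in> K a \<Longrightarrow> \<beta> * z - word_value \<Gamma> (fst (E a z)) \<in> K (fst (snd (E a z)))"
    by metis
  define step where "step = (\<lambda>(a, z). (fst (snd (E a z)), \<beta> * z - word_value \<Gamma> (fst (E a z))))"
  define y where "y n = (step ^^ n) (a, z)" for n
  define x where "x n = E (fst (y n)) (snd (y n))" for n
  have y_Suc: "y (Suc n) = (fst (snd (x n)), \<beta> * snd (y n) - word_value \<Gamma> (fst (x n)))" for n
    by (simp add: y_def x_def step_def split: prod.split)
  have yK: "snd (y n) \<in> K (fst (y n))" for n
  proof (induction n)
    case 0 show ?case using z by (simp add: y_def)
  next
    case (Suc n)
    then show ?case using E(2)[OF Suc] by (simp add: y_Suc x_def)
  qed
  have "x n \<in> labels \<sigma> (fst (y n))" for n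
    unfolding x_def by (rule E(1)[OF yK])
  hence xa: "x \<in> label_seqs \<sigma> a"
    unfolding label_seqs_def using y_Suc by (auto simp: y_def[of 0] dest: spec) (metis fst_conv funpow_0 y_def, metis fst_conv)
  have partial: "z = (\<Sum>m<n. word_value \<Gamma> (fst (x m)) / \<beta> ^ Suc m) + snd (y n) / \<beta> ^ n" for n
  proof (induction n)
    case 0 show ?case by (simp add: y_def)
  next
    case (Suc n)
    have "\<beta> \<noteq> 0" using \<beta> by auto
    hence "snd (y n) / \<beta> ^ n = word_value \<Gamma> (fst (x n)) / \<beta> ^ Suc n + snd (y (Suc n)) / \<beta> ^ Suc n"
      by (simp add: y_Suc field_simps)
    with Suc show ?case by simp
  qed
  have "(\<lambda>n. snd (y n) / \<beta> ^ n) \<longlonglongrightarrow> 0"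
  proof (rule Lim_null_comparison)
    show "\<forall>\<^sub>F n in sequentially. norm (snd (y n) / \<beta> ^ n) \<le> M * (1 / cmod \<beta>) ^ n"
      using bnd[OF yK]
      by (intro always_eventually) (auto simp: norm_divide norm_power power_divide intro!: divide_right_mono)
    have "(\<lambda>n. (1 / cmod \<beta>) ^ n) \<longlonglongrightarrow> 0"
      using \<beta> by (intro LIMSEQ_realpow_zero) (auto simp: divide_less_eq)
    from tendsto_mult_left[OF this, of M] show "(\<lambda>n. M * (1 / cmod \<beta>) ^ n) \<longlonglongrightarrow> 0"
      by simp
  qed
  hence "(\<lambda>n. z - snd (y n) / \<beta> ^ n) \<longlonglongrightarrow> z - 0"
    by (intro tendsto_intros)
  moreover have "z - snd (y n) / \<beta> ^ n = (\<Sum>m<n. word_value \<Gamma> (fst (x m)) / \<beta> ^ Suc m)" for n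
    using partial[of n] by (simp add: algebra_simps)
  ultimately have "(\<lambda>m. word_value \<Gamma> (fst (x m)) / \<beta> ^ Suc m) sums z"
    unfolding sums_def by simp
  hence "frac_point \<beta> \<Gamma> x = z"
    unfolding frac_point_def by (rule sums_unique[symmetric])
  thus "z \<in> fractal \<sigma> \<beta> \<Gamma> a"
    unfolding fractal_def using xa by blast
qed

text \<open>The closures of the fractals are again bounded and invariant, since a finite union of
  images of compact sets is closed; so by maximality they add no new points.\<close>

lemma compact_fractal:
  fixes \<Gamma> :: "complex^'a::finite"
  assumes \<beta>: "cmod \<beta> > 1"
  shows "compact (fractal \<sigma> \<beta> \<Gamma> a)"
proof -
  let ?F = "fractal \<sigma> \<beta> \<Gamma>"
  obtain M where M: "\<And>a z. z \<in> ?F a \<Longrightarrow> cmod z \<le> M"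
    using bounded_fractals[OF \<beta>] by blast
  have bounded: "bounded (?F a)" for a
    unfolding bounded_iff using M by blast
  have "closure (?F a) \<subseteq> ?F a" for a
  proof (rule bounded_invariant_subset_fractal[OF \<beta>])
    have "closure (?F a) \<subseteq> cball 0 M" for a
      by (rule closure_minimal) (use M in auto)
    thus "z \<in> closure (?F a) \<Longrightarrow> cmod z \<le> M" for a z
      by fastforce
  next
    fix a z assume z: "z \<in> closure (?F a)"
    let ?g = "\<lambda>e z. (word_value \<Gamma> (fst e) + z) / \<beta>"
    let ?U = "\<Union>e\<in>labels \<sigma> a. ?g e ` closure (?F (fst (snd e)))"
    have "closed ?U"
    proof (intro closed_UN finite_labels ballI compact_imp_closed compact_continuous_image)
      fix e show "continuous_on (closure (?F (fst (snd e)))) (?g e)"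
        using \<beta> by (intro continuous_intros) auto
      show "compact (closure (?F (fst (snd e))))"
        using bounded compact_closure by blast
    qed
    moreover have "?F a \<subseteq> ?U"
      unfolding fractal_eq_UN_subfractal[of \<sigma> \<beta> \<Gamma> a]
    proof (rule UN_mono)
      fix e assume "e \<in> labels \<sigma> a"
      thus "subfractal \<sigma> \<beta> \<Gamma> a e \<subseteq> ?g e ` closure (?F (fst (snd e)))"
        by (cases e) (auto simp: subfractal_eq_image[OF \<beta>] intro!: imageI subsetD[OF closure_subset])
    qed simp
    ultimately have "z \<in> ?U"
      using closure_minimal z by blast
    thus "\<exists>p c s. (p, c, s) \<in> labels \<sigma> a \<and> (\<exists>y\<in>closure (?F c). z = (word_value \<Gamma> p + y) / \<beta>)"
      by (auto simp: image_iff) (metis fst_conv snd_conv)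
  qed
  with bounded show ?thesis
    by (metis closure_subset compact_closure subset_antisym)
qed

lemma fractal_nonempty: "\<forall>a. \<sigma> a \<noteq> [] \<Longrightarrow> fractal \<sigma> \<beta> \<Gamma> a \<noteq> {}"
  using label_seqs_nonempty by (simp add: fractal_def)

lemma compact_subfractal:
  fixes \<Gamma> :: "complex^'a::finite"
  assumes \<beta>: "cmod \<beta> > 1" and "e \<in> labels \<sigma> a"
  shows "compact (subfractal \<sigma> \<beta> \<Gamma> a e)"
proof (cases e)
  case (fields p c s)
  show ?thesis
    unfolding fields using \<beta> assms(2)
    by (subst subfractal_eq_image)
       (auto simp: fields intro!: compact_continuous_image continuous_intros compact_fractal)
qed

lemma subfractal_nonempty:
  fixes \<Gamma> :: "complex^'a::finite"
  assumes "cmod \<beta> > 1" "\<forall>a. \<sigma> a \<noteq> []" "e \<in> labels \<sigma> a"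
  shows "subfractal \<sigma> \<beta> \<Gamma> a e \<noteq> {}"
  using assms fractal_nonempty[OF assms(2)] by (cases e) (auto simp: subfractal_eq_image)

section \<open>Support values near a direction\<close>

lemma support_min_lower:
  assumes "compact K" "z \<in> K"
  shows "support_min K \<tau> \<le> Re (\<tau> * z)"
proof -
  have "compact ((\<lambda>z. Re (\<tau> * z)) ` K)"
    using assms(1) by (intro compact_continuous_image continuous_intros)
  hence "bdd_below ((\<lambda>z. Re (\<tau> * z)) ` K)"
    by (intro bounded_imp_bdd_below compact_imp_bounded)
  thus ?thesis
    unfolding support_min_def using assms(2) by (rule cINF_lower)
qed

lemma support_min_greatest:
  assumes "K \<noteq> {}" "\<And>z. z \<in> K \<Longrightarrow> m \<le> Re (\<tau> * z)"
  shows "m \<le> support_min K \<tau>"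
  unfolding support_min_def using assms by (rule cINF_greatest)

lemma support_min_attained:
  assumes "compact K" "K \<noteq> {}"
  obtains z where "z \<in> K" "Re (\<tau> * z) = support_min K \<tau>"
proof -
  obtain z where z: "z \<in> K" "\<And>y. y \<in> K \<Longrightarrow> Re (\<tau> * z) \<le> Re (\<tau> * y)"
    using continuous_attains_inf[OF assms continuous_on_Re[OF continuous_on_mult_left[OF continuous_on_id]], of \<tau>]
    by blast
  from z(1) support_min_lower[OF assms(1) z(1)] support_min_greatest[OF assms(2) z(2)] show ?thesis
    by (intro that[of z] antisym) auto
qed

lemma support_min_mono:
  assumes "compact K" "L \<subseteq> K" "L \<noteq> {}"
  shows "support_min K \<tau> \<le> support_min L \<tau>"
  using assms by (intro support_min_greatest support_min_lower) auto

lemma support_min_image_affine: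
  assumes "K \<noteq> {}" "compact K"
  shows "support_min ((\<lambda>z. (w + z) / b) ` K) \<tau> = Re (\<tau> / b * w) + support_min K (\<tau> / b)"
proof (rule antisym)
  have eq: "Re (\<tau> * ((w + z) / b)) = Re (\<tau> / b * w) + Re (\<tau> / b * z)" for z
  proof -
    have "\<tau> * ((w + z) / b) = \<tau> / b * w + \<tau> / b * z"
      by (simp add: algebra_simps add_divide_distrib)
    thus ?thesis by (simp only: plus_complex.sel)
  qed
  have cpt: "compact ((\<lambda>z. (w + z) / b) ` K)"
  proof (cases "b = 0")
    case True
    thus ?thesis using assms(1) by (simp add: image_constant_conv)
  next
    case False
    thus ?thesis using assms(2) by (intro compact_continuous_image continuous_intros) auto
  qed
  obtain z where "z \<in> K" "Re (\<tau> / b * z) = support_min K (\<tau> / b)"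
    using support_min_attained[OF assms(2,1)] by blast
  thus "support_min ((\<lambda>z. (w + z) / b) ` K) \<tau> \<le> Re (\<tau> / b * w) + support_min K (\<tau> / b)"
    using support_min_lower[OF cpt, of "(w + z) / b" \<tau>] eq by (metis image_eqI)
  show "Re (\<tau> / b * w) + support_min K (\<tau> / b) \<le> support_min ((\<lambda>z. (w + z) / b) ` K) \<tau>"
  proof (rule support_min_greatest)
    fix y assume "y \<in> (\<lambda>z. (w + z) / b) ` K"
    then obtain z where "z \<in> K" "y = (w + z) / b" by blast
    thus "Re (\<tau> / b * w) + support_min K (\<tau> / b) \<le> Re (\<tau> * y)"
      using support_min_lower[OF assms(2), of z "\<tau> / b"] eq[of z] by simp
  qed (use assms(1) in simp)
qed

text \<open>The numbers \<open>v\<close> and \<open>y\<close> are the values of \<open>u\<close> and \<open>w\<close> at a competing point which lies on the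
  supporting line \<open>u = v\<close> of \<open>K\<close> and is strictly below \<open>K\<close> there as measured by \<open>w\<close>. After a
  small turn of the functional from \<open>u\<close> to \<open>c u + s w\<close>, points of \<open>K\<close> with \<open>w\<close> above
  \<open>y + \<kappa>\<close> lose by \<open>\<kappa> s\<close> because of \<open>w\<close>. The other points of \<open>K\<close> form a compact set that
  misses the line, so they lose by a fixed amount because of \<open>u\<close>.\<close>

lemma linear_gap:
  fixes u w :: "complex \<Rightarrow> real"
  assumes K: "compact K" and u: "continuous_on K u" and w: "continuous_on K w"
    and uv: "\<And>z. z \<in> K \<Longrightarrow> v \<le> u z"
    and wy: "\<And>z. z \<in> K \<Longrightarrow> u z = v \<Longrightarrow> y < w z"
  shows "\<exists>\<delta>>0. \<exists>\<kappa>>0. \<forall>c s. 1/2 \<le> c \<longrightarrow> 0 \<le> s \<longrightarrow> s < \<delta> \<longrightarrow>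
           (\<forall>z\<in>K. c * v + s * y + \<kappa> * s \<le> c * u z + s * w z)"
proof -
  have cpt_le: "compact {z \<in> K. g z \<le> b}" if "continuous_on K g" for g :: "complex \<Rightarrow> real" and b
  proof -
    have "compact (K \<inter> (K \<inter> g -` {..b}))"
      using continuous_closed_preimage[OF that compact_imp_closed[OF K] closed_atMost[of b]]
      by (rule compact_Int_closed[OF K])
    moreover have "K \<inter> (K \<inter> g -` {..b}) = {z \<in> K. g z \<le> b}" by auto
    ultimately show ?thesis by simp
  qed
  have "\<exists>\<kappa>>0. \<forall>z\<in>K. u z = v \<longrightarrow> y + \<kappa> < w z"
  proof (cases "{z \<in> K. u z \<le> v} = {}")
    case True
    thus ?thesis by (intro exI[of _ 1]) auto
  next
    case False
    moreover have "continuous_on {z \<in> K. u z \<le> v} w"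
      using w by (rule continuous_on_subset) auto
    ultimately obtain z0 where z0: "z0 \<in> K" "u z0 \<le> v" "\<And>z. z \<in> K \<Longrightarrow> u z \<le> v \<Longrightarrow> w z0 \<le> w z"
      using continuous_attains_inf[OF cpt_le[OF u]] by blast
    hence "y < w z0" using uv wy by (metis antisym)
    thus ?thesis
      using z0(3) by (intro exI[of _ "(w z0 - y) / 2"]) (force simp: field_simps)
  qed
  then obtain \<kappa> where \<kappa>: "\<kappa> > 0" "\<And>z. z \<in> K \<Longrightarrow> u z = v \<Longrightarrow> y + \<kappa> < w z"
    by blast
  let ?L = "{z \<in> K. w z \<le> y + \<kappa>}"
  have "\<exists>\<eta>>0. \<forall>z\<in>?L. v + \<eta> \<le> u z"
  proof (cases "?L = {}")
    case True
    thus ?thesis by (intro exI[of _ 1]) auto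
  next
    case False
    moreover have "continuous_on ?L u"
      using u by (rule continuous_on_subset) auto
    ultimately obtain z0 where z0: "z0 \<in> ?L" "\<And>z. z \<in> ?L \<Longrightarrow> u z0 \<le> u z"
      using continuous_attains_inf[OF cpt_le[OF w]] by blast
    hence "u z0 > v" using uv \<kappa>(2) by (smt (verit) mem_Collect_eq)
    thus ?thesis using z0(2) by (intro exI[of _ "u z0 - v"]) auto
  qed
  then obtain \<eta> where \<eta>: "\<eta> > 0" "\<And>z. z \<in> ?L \<Longrightarrow> v + \<eta> \<le> u z"
    by blast
  have "bounded (w ` K)"
    using K w by (intro compact_imp_bounded compact_continuous_image)
  then obtain M where M: "M > 0" "\<And>z. z \<in> K \<Longrightarrow> \<bar>w z\<bar> \<le> M"
    unfolding bounded_pos by auto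
  define D where "D = M + \<bar>y\<bar> + \<kappa>"
  have D: "D > 0" using M \<kappa> by (simp add: D_def add_pos_nonneg)
  have "c * v + s * y + \<kappa> * s \<le> c * u z + s * w z"
    if c: "1/2 \<le> c" and s: "0 \<le> s" "s < \<eta> / (2 * D)" and z: "z \<in> K" for c s z
  proof (cases "w z \<le> y + \<kappa>")
    case True
    have "s * (y + \<kappa> - w z) \<le> s * D"
      using M(2)[OF z] s(1) by (intro mult_left_mono) (auto simp: D_def)
    also have "s * D \<le> \<eta> / 2"
      using s(2) D by (simp add: field_simps)
    also have "\<dots> \<le> c * \<eta>"
      using mult_right_mono[OF c, of \<eta>] \<eta>(1) by simp
    also have "\<dots> \<le> c * (u z - v)"
      using \<eta>(2)[of z] True z c by (intro mult_left_mono) auto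
    finally show ?thesis by (simp add: algebra_simps)
  next
    case False
    hence "c * v \<le> c * u z" "s * (y + \<kappa>) \<le> s * w z"
      using uv[OF z] c s by (auto intro!: mult_left_mono)
    thus ?thesis by (simp add: algebra_simps)
  qed
  thus ?thesis
    using \<kappa>(1) \<eta>(1) D by (intro exI[of _ "\<eta> / (2 * D)"] conjI exI[of _ \<kappa>]) auto
qed

text \<open>Crude bounds, used to compare the coefficient \<open>sin t\<close> of the tilted functional with the angle.\<close>

lemma sin_ge_half:
  assumes "0 \<le> t" "t \<le> (1::real)"
  shows "t / 2 \<le> sin t" "1/2 \<le> cos t"
proof -
  have "t \<le> pi / 3" using assms pi_gt3 by linarith
  hence "cos (pi / 3) \<le> cos t" using assms by (subst cos_mono_le_eq) (auto intro: order_trans)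
  thus c: "1/2 \<le> cos t" by (simp add: cos_60)
  have "t \<le> tan t"
    using abs_tan_ge[of t] assms pi_gt3 tan_pos_pi2_le[of t] by (simp)
  hence "t * cos t \<le> sin t" using c by (simp add: tan_def field_simps)
  moreover have "t * (1/2) \<le> t * cos t" using c assms by (intro mult_left_mono)
  ultimately show "t / 2 \<le> sin t" by simp
qed

lemma Re_rotated: "Re (\<xi> * cis \<theta> * z) = cos \<theta> * Re (\<xi> * z) - sin \<theta> * Im (\<xi> * z)"
proof -
  have "\<xi> * cis \<theta> * z = cis \<theta> * (\<xi> * z)" by simp
  thus ?thesis by (simp only: times_complex.sel cis.sel)
qed

text \<open>Finitely many competitors, each with its own neighbourhood and rate, admit common ones.\<close>

lemma finite_common_positive:
  fixes P :: "'i \<Rightarrow> real \<Rightarrow> real \<Rightarrow> bool"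
  assumes "finite I" and "\<And>i. i \<in> I \<Longrightarrow> \<exists>d>0. \<exists>k>0. P i d k"
    and mono: "\<And>i d k d' k'. P i d k \<Longrightarrow> 0 < d' \<Longrightarrow> d' \<le> d \<Longrightarrow> 0 < k' \<Longrightarrow> k' \<le> k \<Longrightarrow> P i d' k'"
  shows "\<exists>d>0. \<exists>k>0. \<forall>i\<in>I. P i d k"
  using assms(1,2)
proof (induction I rule: finite_induct)
  case empty
  show ?case by (intro exI[of _ 1]) (auto intro: exI[of _ 1])
next
  case (insert i I)
  then obtain d k d' k' where "d > 0" "k > 0" "\<forall>i\<in>I. P i d k" "d' > 0" "k' > 0" "P i d' k'"
    by (metis insertCI)
  thus ?case
    by (intro exI[of _ "min d d'"] exI[of _ "min k k'"] conjI ballI) (auto intro: mono)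
qed

text \<open>For small turns to one side, the winner is the set containing the point \<open>z0\<close> of the supporting
  line that is extreme in the sense of the turn. No other set of the family contains \<open>z0\<close>, so on
  the line all its points are strictly worse and \<open>linear_gap\<close> applies. Turning the other way
  (\<open>r = -1\<close>) reverses the order on the line, so the winner may change with the side.\<close>

lemma one_sided_gap:
  fixes K :: "'i \<Rightarrow> complex set"
  assumes I: "finite I" "I \<noteq> {}" and K: "\<And>i. i \<in> I \<Longrightarrow> compact (K i)" "\<And>i. i \<in> I \<Longrightarrow> K i \<noteq> {}"
    and \<xi>: "\<xi> \<noteq> 0" and r: "r = 1 \<or> r = -1"
    and disj: "\<And>i j z. i \<in> I \<Longrightarrow> j \<in> I \<Longrightarrow> z \<in> K i \<Longrightarrow> z \<in> K j \<Longrightarrow>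
      Re (\<xi> * z) = support_min (\<Union>i\<in>I. K i) \<xi> \<Longrightarrow> i = j"
  shows "\<exists>\<delta>>0. \<exists>\<kappa>>0. \<exists>i\<in>I. \<forall>t. 0 \<le> t \<longrightarrow> t < \<delta> \<longrightarrow> (\<forall>j\<in>I. j \<noteq> i \<longrightarrow>
    support_min (\<Union>i\<in>I. K i) (\<xi> * cis (r * t)) + \<kappa> * t \<le> support_min (K j) (\<xi> * cis (r * t)))"
proof -
  let ?U = "\<Union>i\<in>I. K i"
  define v where "v = support_min ?U \<xi>"
  \<comment> \<open>Turning \<open>\<xi>\<close> by the angle \<open>r t\<close> changes the functional to \<open>cos t * Re (\<xi> z) + sin t * w z\<close>.\<close>
  define w where "w z = - r * Im (\<xi> * z)" for z
  have U: "compact ?U" "?U \<noteq> {}"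
    using I K by (auto intro: compact_UN)
  have uv: "v \<le> Re (\<xi> * z)" if "z \<in> ?U" for z
    unfolding v_def by (rule support_min_lower[OF U(1) that])
  let ?face = "{z \<in> ?U. Re (\<xi> * z) = v}"
  have "?face = ?U \<inter> (\<lambda>z. Re (\<xi> * z)) -` {v}" by auto
  hence "compact ?face"
    using U(1) by (auto intro!: compact_Int_closed continuous_closed_vimage continuous_intros)
  moreover have "?face \<noteq> {}"
    using support_min_attained[OF U, of \<xi>] v_def by blast
  moreover have "continuous_on ?face w"
    unfolding w_def by (intro continuous_intros)
  ultimately obtain z0 where z0: "z0 \<in> ?face" "\<And>z. z \<in> ?face \<Longrightarrow> w z0 \<le> w z"
    using continuous_attains_inf[of ?face w] by blast
  then obtain i where i: "i \<in> I" "z0 \<in> K i" by blast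
  have "\<exists>\<delta>>0. \<exists>\<kappa>>0. \<forall>j\<in>I - {i}. \<forall>c s. 1/2 \<le> c \<longrightarrow> 0 \<le> s \<longrightarrow> s < \<delta> \<longrightarrow>
           (\<forall>z\<in>K j. c * v + s * w z0 + \<kappa> * s \<le> c * Re (\<xi> * z) + s * w z)"
  proof (rule finite_common_positive)
    fix j assume j: "j \<in> I - {i}"
    show "\<exists>\<delta>>0. \<exists>\<kappa>>0. \<forall>c s. 1/2 \<le> c \<longrightarrow> 0 \<le> s \<longrightarrow> s < \<delta> \<longrightarrow>
           (\<forall>z\<in>K j. c * v + s * w z0 + \<kappa> * s \<le> c * Re (\<xi> * z) + s * w z)"
    proof (rule linear_gap)
      show "compact (K j)" using j K by blast
      show "continuous_on (K j) (\<lambda>z. Re (\<xi> * z))" "continuous_on (K j) w"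
        unfolding w_def by (intro continuous_intros)+
      show "v \<le> Re (\<xi> * z)" if "z \<in> K j" for z
        using uv that j by blast
      show "w z0 < w z" if z: "z \<in> K j" "Re (\<xi> * z) = v" for z
      proof (rule ccontr)
        assume "\<not> w z0 < w z"
        moreover have "w z0 \<le> w z" using z j by (intro z0(2)) blast
        ultimately have "Im (\<xi> * z) = Im (\<xi> * z0)" using r unfolding w_def by auto
        hence "\<xi> * z = \<xi> * z0" using z z0(1) by (intro complex_eqI) auto
        hence "z = z0" using \<xi> by simp
        with disj[of i j z0] i j z v_def show False by auto
      qed
    qed
  next
    fix j d k d' k'
    assume *: "\<forall>c s. 1/2 \<le> c \<longrightarrow> 0 \<le> s \<longrightarrow> s < d \<longrightarrow>
           (\<forall>z\<in>K j. c * v + s * w z0 + k * s \<le> c * Re (\<xi> * z) + s * w z)"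
      and dk: "d' \<le> (d::real)" "k' \<le> (k::real)"
    show "\<forall>c s. 1/2 \<le> c \<longrightarrow> 0 \<le> s \<longrightarrow> s < d' \<longrightarrow>
           (\<forall>z\<in>K j. c * v + s * w z0 + k' * s \<le> c * Re (\<xi> * z) + s * w z)"
    proof safe
      fix c s :: real and z assume "1/2 \<le> c" "0 \<le> s" "s < d'" "z \<in> K j"
      with * dk have "c * v + s * w z0 + k * s \<le> c * Re (\<xi> * z) + s * w z" by auto
      moreover have "k' * s \<le> k * s" using dk \<open>0 \<le> s\<close> by (intro mult_right_mono)
      ultimately show "c * v + s * w z0 + k' * s \<le> c * Re (\<xi> * z) + s * w z" by linarith
    qed
  qed (use I in auto)
  then obtain \<delta> \<kappa> where \<delta>: "\<delta> > 0" "\<kappa> > 0" and gap: "\<And>j c s z. j \<in> I \<Longrightarrow> j \<noteq> i \<Longrightarrow> 1/2 \<le> c \<Longrightarrow> 0 \<le> s \<Longrightarrow> s < \<delta> \<Longrightarrow>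
      z \<in> K j \<Longrightarrow> c * v + s * w z0 + \<kappa> * s \<le> c * Re (\<xi> * z) + s * w z"
    by blast
  have rot: "Re (\<xi> * cis (r * t) * z) = cos t * Re (\<xi> * z) + sin t * w z" for t z
    using r by (auto simp: Re_rotated w_def simp del: times_complex.sel)
  have "support_min ?U (\<xi> * cis (r * t)) + \<kappa> / 2 * t \<le> support_min (K j) (\<xi> * cis (r * t))"
    if t: "0 \<le> t" "t < min \<delta> 1" and j: "j \<in> I" "j \<noteq> i" for t j
  proof -
    have sc: "t / 2 \<le> sin t" "1/2 \<le> cos t"
      using sin_ge_half[of t] t by auto
    have s: "0 \<le> sin t" "sin t < \<delta>"
      using sc t sin_x_le_x[of t] by auto
    have "support_min ?U (\<xi> * cis (r * t)) + \<kappa> / 2 * t \<le> Re (\<xi> * cis (r * t) * z0) + \<kappa> * sin t"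
      using mult_left_mono[OF sc(1), of \<kappa>] \<delta> z0(1) i
      by (intro add_mono support_min_lower U) auto
    also have "\<dots> = cos t * v + sin t * w z0 + \<kappa> * sin t"
      using z0(1) unfolding rot by simp
    also have "\<dots> \<le> support_min (K j) (\<xi> * cis (r * t))"
      using gap[OF j sc(2) s] K j by (intro support_min_greatest) (auto simp only: rot)
    finally show ?thesis .
  qed
  thus ?thesis
    using \<delta> i(1) by (intro exI[of _ "min \<delta> 1"] conjI exI[of _ "\<kappa> / 2"] bexI[of _ i]) auto
qed

text \<open>The two sides of \<open>\<xi>\<close> have different winners in general, so the winner depends on the sign of
  \<open>\<theta>\<close>.\<close>

lemma local_gap:
  fixes K :: "'i \<Rightarrow> complex set"
  assumes I: "finite I" "I \<noteq> {}" and K: "\<And>i. i \<in> I \<Longrightarrow> compact (K i)" "\<And>i. i \<in> I \<Longrightarrow> K i \<noteq> {}"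
    and \<xi>: "\<xi> \<noteq> 0"
    and disj: "\<And>i j z. i \<in> I \<Longrightarrow> j \<in> I \<Longrightarrow> z \<in> K i \<Longrightarrow> z \<in> K j \<Longrightarrow>
      Re (\<xi> * z) = support_min (\<Union>i\<in>I. K i) \<xi> \<Longrightarrow> i = j"
  shows "\<exists>\<delta>>0. \<exists>\<kappa>>0. \<forall>\<theta>. \<bar>\<theta>\<bar> < \<delta> \<longrightarrow> (\<exists>i\<in>I. \<forall>j\<in>I. j \<noteq> i \<longrightarrow>
    support_min (\<Union>i\<in>I. K i) (\<xi> * cis \<theta>) + \<kappa> * \<bar>\<theta>\<bar> \<le> support_min (K j) (\<xi> * cis \<theta>))"
proof -
  have side: "\<exists>\<delta>>0. \<exists>\<kappa>>0. \<exists>i\<in>I. \<forall>t. 0 \<le> t \<longrightarrow> t < \<delta> \<longrightarrow> (\<forall>j\<in>I. j \<noteq> i \<longrightarrow>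
      support_min (\<Union>i\<in>I. K i) (\<xi> * cis (r * t)) + \<kappa> * t \<le> support_min (K j) (\<xi> * cis (r * t)))"
    if "r = 1 \<or> r = -1" for r
    by (rule one_sided_gap) (fact I K \<xi> that | erule (4) disj)+
  obtain d k i where 1: "d > 0" "k > 0" "i \<in> I" "\<And>t j. 0 \<le> t \<Longrightarrow> t < d \<Longrightarrow> j \<in> I \<Longrightarrow> j \<noteq> i \<Longrightarrow>
    support_min (\<Union>i\<in>I. K i) (\<xi> * cis (1 * t)) + k * t \<le> support_min (K j) (\<xi> * cis (1 * t))"
    using side[of 1] by blast
  obtain d' k' i' where 2: "d' > 0" "k' > 0" "i' \<in> I" "\<And>t j. 0 \<le> t \<Longrightarrow> t < d' \<Longrightarrow> j \<in> I \<Longrightarrow> j \<noteq> i' \<Longrightarrow>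
    support_min (\<Union>i\<in>I. K i) (\<xi> * cis (-1 * t)) + k' * t \<le> support_min (K j) (\<xi> * cis (-1 * t))"
    using side[of "-1"] by blast
  have "\<exists>i\<in>I. \<forall>j\<in>I. j \<noteq> i \<longrightarrow>
    support_min (\<Union>i\<in>I. K i) (\<xi> * cis \<theta>) + min k k' * \<bar>\<theta>\<bar> \<le> support_min (K j) (\<xi> * cis \<theta>)"
    if \<theta>: "\<bar>\<theta>\<bar> < min d d'" for \<theta>
  proof (cases "0 \<le> \<theta>")
    case True
    have "min k k' * \<bar>\<theta>\<bar> \<le> k * \<theta>" using True by (intro mult_mono) (use 1 in auto)
    with 1(4)[of \<theta>] True \<theta> show ?thesis by (intro bexI[OF _ 1(3)]) force
  next
    case False
    have "min k k' * \<bar>\<theta>\<bar> \<le> k' * (- \<theta>)" using False by (intro mult_mono) (use 2 in auto)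
    moreover have "support_min (\<Union>i\<in>I. K i) (\<xi> * cis \<theta>) + k' * (- \<theta>) \<le> support_min (K j) (\<xi> * cis \<theta>)"
      if "j \<in> I" "j \<noteq> i'" for j
      using 2(4)[of "- \<theta>" j] False \<theta> that by simp
    ultimately show ?thesis by (intro bexI[OF _ 2(3)]) force
  qed
  thus ?thesis
    using 1 2 by (intro exI[of _ "min d d'"] conjI exI[of _ "min k k'"]) auto
qed

lemma norm_cis_diff_le: "cmod (cis \<theta> - 1) \<le> \<bar>\<theta>\<bar>"
  using dist_exp_i_1[of \<theta>] abs_sin_x_le_abs_x[of "\<theta> / 2"] by (simp add: cis_conv_exp)

lemma support_min_rotation_lipschitz:
  assumes K: "compact K" "K \<noteq> {}" and M: "\<And>z. z \<in> K \<Longrightarrow> cmod z \<le> M" and \<xi>: "cmod \<xi> = 1"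
  shows "\<bar>support_min K (\<xi> * cis \<theta>) - support_min K \<xi>\<bar> \<le> M * \<bar>\<theta>\<bar>"
proof -
  have *: "\<bar>Re (\<xi> * cis \<theta> * z) - Re (\<xi> * z)\<bar> \<le> M * \<bar>\<theta>\<bar>" if "z \<in> K" for z
  proof -
    have "\<bar>Re (\<xi> * cis \<theta> * z) - Re (\<xi> * z)\<bar> = \<bar>Re (\<xi> * z * (cis \<theta> - 1))\<bar>"
      by (simp add: algebra_simps)
    also have "\<dots> \<le> cmod (\<xi> * z * (cis \<theta> - 1))" by (rule abs_Re_le_cmod)
    also have "\<dots> = cmod z * cmod (cis \<theta> - 1)" using \<xi> by (simp add: norm_mult)
    also have "\<dots> \<le> M * \<bar>\<theta>\<bar>"
      using M[OF that] norm_cis_diff_le by (intro mult_mono) (auto intro: order_trans[OF norm_ge_zero])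
    finally show ?thesis .
  qed
  have "support_min K (\<xi> * cis \<theta>) \<le> support_min K \<xi> + M * \<bar>\<theta>\<bar>"
  proof -
    obtain z where z: "z \<in> K" "Re (\<xi> * z) = support_min K \<xi>" using support_min_attained[OF K] .
    with *[OF z(1)] support_min_lower[OF K(1) z(1), of "\<xi> * cis \<theta>"] show ?thesis by linarith
  qed
  moreover have "support_min K \<xi> \<le> support_min K (\<xi> * cis \<theta>) + M * \<bar>\<theta>\<bar>"
  proof -
    obtain z where z: "z \<in> K" "Re (\<xi> * cis \<theta> * z) = support_min K (\<xi> * cis \<theta>)"
      using support_min_attained[OF K] .
    with *[OF z(1)] support_min_lower[OF K(1) z(1), of \<xi>] show ?thesis by linarith
  qed
  ultimately show ?thesis by linarith
qed

text \<open>When only one set attains the minimum at \<open>\<xi>\<close>, continuity of the support values suffices and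
  the gap does not shrink as the direction approaches \<open>\<xi>\<close>.\<close>

lemma local_gap_no_tie:
  fixes K :: "'i \<Rightarrow> complex set"
  assumes I: "finite I" "I \<noteq> {}" and K: "\<And>i. i \<in> I \<Longrightarrow> compact (K i)" "\<And>i. i \<in> I \<Longrightarrow> K i \<noteq> {}"
    and \<xi>: "cmod \<xi> = 1"
    and no_tie: "\<And>i j. i \<in> I \<Longrightarrow> j \<in> I \<Longrightarrow> support_min (K i) \<xi> = support_min (\<Union>i\<in>I. K i) \<xi> \<Longrightarrow>
      support_min (K j) \<xi> = support_min (\<Union>i\<in>I. K i) \<xi> \<Longrightarrow> i = j"
  shows "\<exists>\<delta>>0. \<exists>\<kappa>>0. \<forall>\<theta>. \<bar>\<theta>\<bar> < \<delta> \<longrightarrow> (\<exists>i\<in>I. \<forall>j\<in>I. j \<noteq> i \<longrightarrow>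
    support_min (\<Union>i\<in>I. K i) (\<xi> * cis \<theta>) + \<kappa> \<le> support_min (K j) (\<xi> * cis \<theta>))"
proof -
  let ?U = "\<Union>i\<in>I. K i"
  define v where "v = support_min ?U \<xi>"
  have U: "compact ?U" "?U \<noteq> {}"
    using I K by (auto intro: compact_UN)
  obtain M where M: "M > 0" "\<And>z. z \<in> ?U \<Longrightarrow> cmod z \<le> M"
    using compact_imp_bounded[OF U(1)] unfolding bounded_pos by blast
  obtain z0 where "z0 \<in> ?U" "Re (\<xi> * z0) = v"
    using support_min_attained[OF U, of \<xi>] v_def by metis
  then obtain i where "i \<in> I" "z0 \<in> K i" "Re (\<xi> * z0) = v"
    by blast
  hence i: "i \<in> I" "support_min (K i) \<xi> \<le> v"
    using support_min_lower[OF K(1), of i z0 \<xi>] by auto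
  have vle: "v \<le> support_min (K j) \<xi>" if "j \<in> I" for j
    unfolding v_def using that K by (intro support_min_mono U) auto
  have "\<exists>d>(0::real). \<exists>k>0. \<forall>j\<in>I - {i}. v + k \<le> support_min (K j) \<xi>"
  proof (rule finite_common_positive[where P = "\<lambda>j d k. v + k \<le> support_min (K j) \<xi>"])
    fix j assume j: "j \<in> I - {i}"
    have "support_min (K i) \<xi> = v"
      using i vle[of i] by simp
    hence "support_min (K j) \<xi> \<noteq> v"
      using no_tie[of i j] i(1) j unfolding v_def[symmetric] by auto
    hence "v < support_min (K j) \<xi>"
      using vle[of j] j by simp
    thus "\<exists>d>(0::real). \<exists>k>0. v + k \<le> support_min (K j) \<xi>"
      by (intro exI[of _ 1] conjI exI[of _ "support_min (K j) \<xi> - v"]) auto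
  next
    fix j and d k d' k' :: real
    assume "v + k \<le> support_min (K j) \<xi>" "k' \<le> k"
    thus "v + k' \<le> support_min (K j) \<xi>" by linarith
  qed (use I in blast)
  then obtain k where k: "k > 0" "\<And>j. j \<in> I \<Longrightarrow> j \<noteq> i \<Longrightarrow> v + k \<le> support_min (K j) \<xi>"
    by blast
  have "support_min ?U (\<xi> * cis \<theta>) + k / 3 \<le> support_min (K j) (\<xi> * cis \<theta>)"
    if \<theta>: "\<bar>\<theta>\<bar> < k / (3 * M)" and j: "j \<in> I" "j \<noteq> i" for \<theta> j
  proof -
    have small: "M * \<bar>\<theta>\<bar> \<le> k / 3" using \<theta> M by (simp add: field_simps)
    have "\<bar>support_min ?U (\<xi> * cis \<theta>) - v\<bar> \<le> M * \<bar>\<theta>\<bar>"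
      unfolding v_def by (intro support_min_rotation_lipschitz U M \<xi>)
    moreover have "\<bar>support_min (K j) (\<xi> * cis \<theta>) - support_min (K j) \<xi>\<bar> \<le> M * \<bar>\<theta>\<bar>"
      using j K M by (intro support_min_rotation_lipschitz \<xi>) auto
    ultimately show ?thesis using small k(2)[OF j] by linarith
  qed
  thus ?thesis
    using k M i by (intro exI[of _ "k / (3 * M)"] conjI exI[of _ "k / 3"]) auto
qed

section \<open>The gap between competing labels\<close>

text \<open>An extreme point in two subfractals would have two representations, distinguished by their
  first label.\<close>

lemma unique_representation_labels_disjoint:
  assumes "unique_representation \<sigma> \<beta> \<Gamma>" "cmod \<xi> = 1"
    and "e \<in> labels \<sigma> a" "z \<in> subfractal \<sigma> \<beta> \<Gamma> a e" "z \<in> subfractal \<sigma> \<beta> \<Gamma> a e'"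
    and "Re (\<xi> * z) = support_min (fractal \<sigma> \<beta> \<Gamma> a) \<xi>"
  shows "e = e'"
proof -
  have "z \<in> fractal \<sigma> \<beta> \<Gamma> a"
    using assms(3,4) fractal_eq_UN_subfractal by blast
  hence "extreme_for (fractal \<sigma> \<beta> \<Gamma> a) \<xi> z"
    using assms(6) by (simp add: extreme_for_def)
  moreover have "\<xi> \<in> sphere 0 1" using assms(2) by simp
  ultimately have uniq: "\<exists>!x. x \<in> label_seqs \<sigma> a \<and> frac_point \<beta> \<Gamma> x = z"
    using assms(1) unfolding unique_representation_def by blast
  obtain x x' where "x \<in> label_seqs \<sigma> a" "x 0 = e" "z = frac_point \<beta> \<Gamma> x"
    and "x' \<in> label_seqs \<sigma> a" "x' 0 = e'" "z = frac_point \<beta> \<Gamma> x'"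
    using assms(4,5) unfolding subfractal_def label_seqs_from_def by auto
  with uniq show "e = e'" by metis
qed

text \<open>The two rates must be kept apart. The orbit of directions keeps a controlled distance only from
  tie directions; it may come arbitrarily close to any other \<open>\<xi>\<close>, where a gap of order
  \<open>\<bar>\<theta>\<bar>\<close> would be worthless.\<close>

lemma label_gap_near:
  fixes \<Gamma> :: "complex^'a::finite"
  assumes \<beta>: "cmod \<beta> > 1" and ne: "\<forall>a. \<sigma> a \<noteq> []" and urp: "unique_representation \<sigma> \<beta> \<Gamma>"
    and \<xi>: "cmod \<xi> = 1"
  shows "\<exists>\<delta>>0. \<exists>\<kappa>>0. \<forall>\<theta>. \<bar>\<theta>\<bar> < \<delta> \<longrightarrow> (\<exists>e\<in>labels \<sigma> a. \<forall>e'\<in>labels \<sigma> a. e' \<noteq> e \<longrightarrow>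
    support_min (fractal \<sigma> \<beta> \<Gamma> a) (\<xi> * cis \<theta>) + \<kappa> * (if \<xi> \<in> tie_dirs_at \<sigma> \<beta> \<Gamma> a then \<bar>\<theta>\<bar> else 1)
      \<le> support_min (subfractal \<sigma> \<beta> \<Gamma> a e') (\<xi> * cis \<theta>))"
proof (cases "\<xi> \<in> tie_dirs_at \<sigma> \<beta> \<Gamma> a")
  case True
  have "\<exists>\<delta>>0. \<exists>\<kappa>>0. \<forall>\<theta>. \<bar>\<theta>\<bar> < \<delta> \<longrightarrow> (\<exists>e\<in>labels \<sigma> a. \<forall>e'\<in>labels \<sigma> a. e' \<noteq> e \<longrightarrow>
    support_min (\<Union>e\<in>labels \<sigma> a. subfractal \<sigma> \<beta> \<Gamma> a e) (\<xi> * cis \<theta>) + \<kappa> * \<bar>\<theta>\<bar>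
      \<le> support_min (subfractal \<sigma> \<beta> \<Gamma> a e') (\<xi> * cis \<theta>))"
  proof (rule local_gap)
    show "\<xi> \<noteq> 0" using \<xi> by auto
    show "i = j" if "i \<in> labels \<sigma> a" "z \<in> subfractal \<sigma> \<beta> \<Gamma> a i" "z \<in> subfractal \<sigma> \<beta> \<Gamma> a j"
      "Re (\<xi> * z) = support_min (\<Union>e\<in>labels \<sigma> a. subfractal \<sigma> \<beta> \<Gamma> a e) \<xi>" for i j z
      using unique_representation_labels_disjoint[OF urp \<xi> that(1-3)] that(4)
      unfolding fractal_eq_UN_subfractal[symmetric] by blast
  qed (simp_all add: \<beta> ne finite_labels labels_nonempty compact_subfractal subfractal_nonempty)
  with True show ?thesis
    unfolding fractal_eq_UN_subfractal[symmetric] by simp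
next
  case False
  have "\<exists>\<delta>>0. \<exists>\<kappa>>0. \<forall>\<theta>. \<bar>\<theta>\<bar> < \<delta> \<longrightarrow> (\<exists>e\<in>labels \<sigma> a. \<forall>e'\<in>labels \<sigma> a. e' \<noteq> e \<longrightarrow>
    support_min (\<Union>e\<in>labels \<sigma> a. subfractal \<sigma> \<beta> \<Gamma> a e) (\<xi> * cis \<theta>) + \<kappa>
      \<le> support_min (subfractal \<sigma> \<beta> \<Gamma> a e') (\<xi> * cis \<theta>))"
  proof (rule local_gap_no_tie)
    show "i = j" if "i \<in> labels \<sigma> a" "j \<in> labels \<sigma> a"
      "support_min (subfractal \<sigma> \<beta> \<Gamma> a i) \<xi> = support_min (\<Union>e\<in>labels \<sigma> a. subfractal \<sigma> \<beta> \<Gamma> a e) \<xi>"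
      "support_min (subfractal \<sigma> \<beta> \<Gamma> a j) \<xi> = support_min (\<Union>e\<in>labels \<sigma> a. subfractal \<sigma> \<beta> \<Gamma> a e) \<xi>"
      for i j
    proof (rule ccontr)
      assume "i \<noteq> j"
      hence "\<exists>e\<in>labels \<sigma> a. \<exists>e'\<in>labels \<sigma> a. e \<noteq> e' \<and>
          support_min (fractal \<sigma> \<beta> \<Gamma> a) \<xi> = support_min (subfractal \<sigma> \<beta> \<Gamma> a e) \<xi> \<and>
          support_min (fractal \<sigma> \<beta> \<Gamma> a) \<xi> = support_min (subfractal \<sigma> \<beta> \<Gamma> a e') \<xi>"
        using that unfolding fractal_eq_UN_subfractal[symmetric] by metis
      hence "\<xi> \<in> tie_dirs_at \<sigma> \<beta> \<Gamma> a"
        using \<xi> unfolding tie_dirs_at_def by simp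
      with False show False by contradiction
    qed
  qed (simp_all add: \<beta> ne \<xi> finite_labels labels_nonempty compact_subfractal subfractal_nonempty)
  with False show ?thesis
    unfolding fractal_eq_UN_subfractal[symmetric] by simp
qed

lemma arc_dist_cis:
  assumes "\<bar>\<theta>\<bar> < pi"
  shows "arc_dist (cis \<phi>) (cis (\<phi> + \<theta>)) = \<bar>\<theta>\<bar>"
proof -
  have "Arg (cis (- \<theta>)) = - \<theta>"
    using assms by (intro Arg_cis) auto
  thus ?thesis by (simp add: arc_dist_def cis_divide)
qed

lemma finite_uniform_lower_bound:
  fixes f :: "'b \<Rightarrow> real"
  assumes "finite S" "\<And>x. x \<in> S \<Longrightarrow> 0 < f x"
  shows "\<exists>k>0. \<forall>x\<in>S. k \<le> f x"
  \<comment> \<open>The element \<open>1\<close> takes care of an empty \<open>S\<close>.\<close>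
  using assms by (intro exI[of _ "Min (insert 1 (f ` S))"]) auto

text \<open>Finitely many of the neighbourhoods from \<open>label_gap_near\<close> cover the circle. In a neighbourhood
  of a tie direction \<open>\<xi>\<close> the gap is linear in the distance of \<open>\<tau>\<^sub>k\<close> to \<open>\<xi>\<close>, and this distance
  is at least \<open>A\<^sup>-\<^sup>k\<close>; in the others it is bounded below. Only finitely many centres are involved, so
  one index from which \<open>away\<close> holds serves them all.\<close>

lemma eventually_label_gap_at:
  fixes \<Gamma> :: "complex^'a::finite"
  assumes \<beta>: "cmod \<beta> > 1" and ne: "\<forall>a. \<sigma> a \<noteq> []" and urp: "unique_representation \<sigma> \<beta> \<Gamma>"
    and A: "1 < A" and \<tau>: "\<And>k. cmod (\<tau> k) = 1"
    and away: "\<And>\<xi>. \<xi> \<in> tie_dirs_at \<sigma> \<beta> \<Gamma> a \<Longrightarrow> \<forall>\<^sub>F k in sequentially. 1 \<le> A ^ k * arc_dist \<xi> (\<tau> k)"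
  shows "\<exists>\<kappa>>0. \<forall>\<^sub>F k in sequentially. \<exists>e\<in>labels \<sigma> a. \<forall>e'\<in>labels \<sigma> a. e' \<noteq> e \<longrightarrow>
    support_min (fractal \<sigma> \<beta> \<Gamma> a) (\<tau> k) + \<kappa> / A ^ k \<le> support_min (subfractal \<sigma> \<beta> \<Gamma> a e') (\<tau> k)"
proof -
  let ?tie = "tie_dirs_at \<sigma> \<beta> \<Gamma> a"
  define gap where "gap \<phi> \<delta> \<kappa> \<longleftrightarrow> (\<forall>\<theta>. \<bar>\<theta>\<bar> < \<delta> \<longrightarrow> (\<exists>e\<in>labels \<sigma> a. \<forall>e'\<in>labels \<sigma> a. e' \<noteq> e \<longrightarrow>
    support_min (fractal \<sigma> \<beta> \<Gamma> a) (cis (\<phi> + \<theta>)) + \<kappa> * (if cis \<phi> \<in> ?tie then \<bar>\<theta>\<bar> else 1)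
      \<le> support_min (subfractal \<sigma> \<beta> \<Gamma> a e') (cis (\<phi> + \<theta>))))" for \<phi> \<delta> \<kappa>
  have "\<exists>\<delta>>0. \<exists>\<kappa>>0. gap \<phi> \<delta> \<kappa>" for \<phi>
    using label_gap_near[OF \<beta> ne urp norm_cis[of \<phi>], of a] unfolding cis_mult gap_def .
  then obtain \<delta> \<kappa> where \<delta>: "\<And>\<phi>. 0 < \<delta> \<phi>" and \<kappa>: "\<And>\<phi>. 0 < \<kappa> \<phi>"
    and gap: "\<And>\<phi>. gap \<phi> (\<delta> \<phi>) (\<kappa> \<phi>)"
    by metis
  have "compact {-pi..pi}" by simp
  then obtain C where C: "finite C" "{-pi..pi} \<subseteq> (\<Union>\<phi>\<in>C. ball \<phi> (min (\<delta> \<phi>) 1))"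
  proof (rule compactE_image[where f = "\<lambda>\<phi>. ball \<phi> (min (\<delta> \<phi>) 1)" and C = UNIV])
    show "{-pi..pi} \<subseteq> (\<Union>\<phi>. ball \<phi> (min (\<delta> \<phi>) 1))"
    proof
      fix \<phi> :: real
      have "\<phi> \<in> ball \<phi> (min (\<delta> \<phi>) 1)" using \<delta>[of \<phi>] by simp
      thus "\<phi> \<in> (\<Union>\<phi>. ball \<phi> (min (\<delta> \<phi>) 1))" by blast
    qed
  qed auto
  obtain \<kappa>0 where \<kappa>0: "\<kappa>0 > 0" "\<And>\<phi>. \<phi> \<in> C \<Longrightarrow> \<kappa>0 \<le> \<kappa> \<phi>"
    using finite_uniform_lower_bound[OF C(1), of \<kappa>] \<kappa> by blast
  have "\<forall>\<^sub>F k in sequentially. \<forall>\<phi>\<in>C. cis \<phi> \<in> ?tie \<longrightarrow> 1 \<le> A ^ k * arc_dist (cis \<phi>) (\<tau> k)"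
    using C(1) away by (auto intro!: eventually_ball_finite)
  hence "\<forall>\<^sub>F k in sequentially. \<exists>e\<in>labels \<sigma> a. \<forall>e'\<in>labels \<sigma> a. e' \<noteq> e \<longrightarrow>
    support_min (fractal \<sigma> \<beta> \<Gamma> a) (\<tau> k) + \<kappa>0 / A ^ k \<le> support_min (subfractal \<sigma> \<beta> \<Gamma> a e') (\<tau> k)"
  proof eventually_elim
    case (elim k)
    have Ak: "1 \<le> A ^ k" using A by simp
    have "Arg (\<tau> k) \<in> {-pi..pi}"
      using Arg_bounded[of "\<tau> k"] by auto
    then obtain \<phi> where \<phi>: "\<phi> \<in> C" "\<bar>Arg (\<tau> k) - \<phi>\<bar> < min (\<delta> \<phi>) 1"
      using C(2) unfolding ball_def dist_real_def by (auto simp: abs_minus_commute)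
    define \<theta> where "\<theta> = Arg (\<tau> k) - \<phi>"
    have "\<tau> k \<noteq> 0" using \<tau>[of k] by auto
    hence \<tau>k: "\<tau> k = cis (\<phi> + \<theta>)"
      using \<tau>[of k] by (simp add: \<theta>_def cis_Arg sgn_eq)
    have "1 / A ^ k \<le> (if cis \<phi> \<in> ?tie then \<bar>\<theta>\<bar> else 1)"
    proof (cases "cis \<phi> \<in> ?tie")
      case True
      have "arc_dist (cis \<phi>) (\<tau> k) = \<bar>\<theta>\<bar>"
        unfolding \<tau>k using \<phi>(2) pi_gt3 by (intro arc_dist_cis) (simp add: \<theta>_def)
      with elim \<phi>(1) True Ak show ?thesis by (auto simp: field_simps)
    qed (use Ak in \<open>simp add: field_simps\<close>)
    hence "\<kappa>0 / A ^ k \<le> \<kappa> \<phi> * (if cis \<phi> \<in> ?tie then \<bar>\<theta>\<bar> else 1)"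
      using mult_mono[OF \<kappa>0(2)[OF \<phi>(1)], of "1 / A ^ k"] \<kappa>[of \<phi>] Ak by simp
    moreover have "\<bar>\<theta>\<bar> < \<delta> \<phi>" using \<phi>(2) by (simp add: \<theta>_def)
    then obtain e where "e \<in> labels \<sigma> a" "\<And>e'. e' \<in> labels \<sigma> a \<Longrightarrow> e' \<noteq> e \<Longrightarrow>
        support_min (fractal \<sigma> \<beta> \<Gamma> a) (\<tau> k) + \<kappa> \<phi> * (if cis \<phi> \<in> ?tie then \<bar>\<theta>\<bar> else 1)
          \<le> support_min (subfractal \<sigma> \<beta> \<Gamma> a e') (\<tau> k)"
      using gap[of \<phi>] unfolding gap_def \<tau>k by blast
    ultimately show ?case
      by (meson add_left_mono order_trans)
  qed
  with \<kappa>0(1) show ?thesis by blast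
qed

lemma eventually_label_gap:
  fixes \<Gamma> :: "complex^'a::finite"
  assumes \<beta>: "cmod \<beta> > 1" and ne: "\<forall>a. \<sigma> a \<noteq> []" and urp: "unique_representation \<sigma> \<beta> \<Gamma>"
    and good: "good_direction \<sigma> \<beta> \<Gamma> \<tau>"
  obtains A \<kappa> where "1 < A" "A < cmod \<beta>" "\<kappa> > 0"
    "\<forall>\<^sub>F k in sequentially. \<forall>a. \<exists>e\<in>labels \<sigma> a. \<forall>e'\<in>labels \<sigma> a. e' \<noteq> e \<longrightarrow>
      support_min (fractal \<sigma> \<beta> \<Gamma> a) (unit_part \<beta> ^ k * \<tau>) + \<kappa> / A ^ k
        \<le> support_min (subfractal \<sigma> \<beta> \<Gamma> a e') (unit_part \<beta> ^ k * \<tau>)"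
proof -
  let ?\<tau> = "\<lambda>k. unit_part \<beta> ^ k * \<tau>"
  obtain A where A: "1 < A" "A < cmod \<beta>" and lim: "\<And>\<xi>. \<xi> \<in> tie_dirs \<sigma> \<beta> \<Gamma> \<Longrightarrow>
      liminf (\<lambda>n. ereal (A ^ n * arc_dist \<xi> (?\<tau> n))) = \<infinity>"
    and \<tau>1: "cmod \<tau> = 1"
    using good unfolding good_direction_def by auto
  have \<tau>: "cmod (?\<tau> k) = 1" for k
    using \<beta> \<tau>1 by (auto simp: unit_part_def norm_mult norm_power norm_divide)
  have away: "\<forall>\<^sub>F k in sequentially. 1 \<le> A ^ k * arc_dist \<xi> (?\<tau> k)"
    if "\<xi> \<in> tie_dirs_at \<sigma> \<beta> \<Gamma> a" for \<xi> a
  proof -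
    have "\<xi> \<in> tie_dirs \<sigma> \<beta> \<Gamma>" using that by (auto simp: tie_dirs_def)
    from lim[OF this] have "1 < liminf (\<lambda>n. ereal (A ^ n * arc_dist \<xi> (?\<tau> n)))" by simp
    from less_LiminfD[OF this] show ?thesis
      by (rule eventually_mono) (simp add: one_ereal_def)
  qed
  define gap where "gap \<kappa> a k \<longleftrightarrow> (\<exists>e\<in>labels \<sigma> a. \<forall>e'\<in>labels \<sigma> a. e' \<noteq> e \<longrightarrow>
    support_min (fractal \<sigma> \<beta> \<Gamma> a) (?\<tau> k) + \<kappa> / A ^ k \<le> support_min (subfractal \<sigma> \<beta> \<Gamma> a e') (?\<tau> k))"
    for \<kappa> a k
  have gap_mono: "gap \<kappa>' a k" if "gap \<kappa> a k" "\<kappa>' \<le> \<kappa>" for \<kappa> \<kappa>' a k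
  proof -
    have "\<kappa>' / A ^ k \<le> \<kappa> / A ^ k"
      using that(2) A(1) by (intro divide_right_mono) auto
    with that(1) show ?thesis
      unfolding gap_def by (meson add_left_mono order_trans)
  qed
  have "\<exists>\<kappa>>0. \<forall>\<^sub>F k in sequentially. gap \<kappa> a k" for a
    unfolding gap_def by (rule eventually_label_gap_at[OF \<beta> ne urp A(1) \<tau> away])
  then obtain \<kappa> where \<kappa>: "\<And>a. \<kappa> a > 0" and ev: "\<And>a. \<forall>\<^sub>F k in sequentially. gap (\<kappa> a) a k"
    by metis
  obtain \<kappa>0 where \<kappa>0: "\<kappa>0 > 0" "\<And>a. \<kappa>0 \<le> \<kappa> a"
    using finite_uniform_lower_bound[of UNIV \<kappa>] \<kappa> by auto
  have "\<forall>\<^sub>F k in sequentially. \<forall>a. gap \<kappa>0 a k"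
    by (intro eventually_all_finite eventually_mono[OF ev]) (rule gap_mono[OF _ \<kappa>0(2)])
  thus ?thesis
    unfolding gap_def by (rule that[OF A \<kappa>0(1)])
qed

section \<open>Renormalised prefix sums\<close>

text \<open>In the recursion for the sums, the optimal label contributes at most the factor \<open>1\<close> relative to
  \<open>exp (- V)\<close>, and each of the at most \<open>R\<close> others at most \<open>exp (- g n)\<close>. The infinite product of
  the factors \<open>1 + R exp (- g n)\<close> converges.\<close>

lemma prefix_weight_bound:
  fixes V :: "nat \<Rightarrow> 'a::finite \<Rightarrow> real" and \<sigma> :: "'a \<Rightarrow> 'a list"
  assumes eig: "eigenvector_for (subst_matrix \<sigma>) \<beta> \<gamma>"
    and lower: "\<And>n a i. i < length (\<sigma> a) \<Longrightarrow>
      V (Suc n) a \<le> Re (\<beta> ^ n * word_value \<gamma> (take i (\<sigma> a))) + V n (\<sigma> a ! i)"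
    and gap: "\<And>n a. N \<le> n \<Longrightarrow> \<exists>i. \<forall>j<length (\<sigma> a). j \<noteq> i \<longrightarrow>
      V (Suc n) a + g n \<le> Re (\<beta> ^ n * word_value \<gamma> (take j (\<sigma> a))) + V n (\<sigma> a ! j)"
    and summ: "summable (\<lambda>n. exp (- g n))"
  shows "\<exists>C>0. \<forall>n\<ge>N. \<forall>a. prefix_weight \<gamma> ((subst_word \<sigma> ^^ n) [a]) \<le> C * exp (- V n a)"
proof -
  let ?Z = "\<lambda>n a. prefix_weight \<gamma> ((subst_word \<sigma> ^^ n) [a])"
  define R where "R = real (Max (range (\<lambda>a. length (\<sigma> a))))"
  have R: "real (length (\<sigma> a)) \<le> R" for a
    unfolding R_def by (intro of_nat_mono Max_ge) auto
  have R0: "0 \<le> R" using R order_trans of_nat_0_le_iff by blast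
  \<comment> \<open>Adding \<open>1\<close> makes the constant positive, as is needed later for \<open>C > 0\<close>.\<close>
  define C0 where "C0 = Max (range (\<lambda>a. ?Z N a * exp (V N a))) + 1"
  have C0: "?Z N a * exp (V N a) \<le> C0" for a
  proof -
    have "?Z N a * exp (V N a) \<le> Max (range (\<lambda>a. ?Z N a * exp (V N a)))"
      by (intro Max_ge) auto
    thus ?thesis unfolding C0_def by linarith
  qed
  have C0_pos: "0 < C0"
  proof -
    have "0 \<le> ?Z N undefined * exp (V N undefined)"
      by (simp add: prefix_weight_nonneg)
    also have "\<dots> \<le> Max (range (\<lambda>a. ?Z N a * exp (V N a)))"
      by (intro Max_ge) auto
    finally show ?thesis by (simp add: C0_def)
  qed
  let ?P = "\<lambda>n. C0 * (\<Prod>k=N..<n. 1 + R * exp (- g k))"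
  have P0: "0 \<le> ?P n" for n
    using C0_pos R0 by (intro mult_nonneg_nonneg prod_nonneg) (auto intro: add_nonneg_nonneg)
  have main: "?Z n a \<le> ?P n * exp (- V n a)" if "N \<le> n" for n a
    using that
  proof (induction n arbitrary: a rule: dec_induct)
    case base
    have "?Z N a = (?Z N a * exp (V N a)) * exp (- V N a)"
      by (simp add: exp_minus)
    also have "\<dots> \<le> C0 * exp (- V N a)"
      by (intro mult_right_mono C0) simp
    finally show ?case by simp
  next
    case (step n)
    define y where "y i = Re (\<beta> ^ n * word_value \<gamma> (take i (\<sigma> a))) + V n (\<sigma> a ! i)" for i
    define E where "E = exp (- V (Suc n) a)"
    obtain i where i: "\<And>j. j < length (\<sigma> a) \<Longrightarrow> j \<noteq> i \<Longrightarrow> V (Suc n) a + g n \<le> y j"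
      using gap[OF step(1), of a] unfolding y_def by blast
    have "?Z (Suc n) a = (\<Sum>j<length (\<sigma> a). exp (- Re (\<beta> ^ n * word_value \<gamma> (take j (\<sigma> a)))) * ?Z n (\<sigma> a ! j))"
      unfolding subst_word_power_Suc_single by (rule prefix_weight_subst_word_power[OF eig])
    also have "\<dots> \<le> (\<Sum>j<length (\<sigma> a). ?P n * exp (- y j))"
    proof (rule sum_mono)
      fix j
      have "exp (- Re (\<beta> ^ n * word_value \<gamma> (take j (\<sigma> a)))) * ?Z n (\<sigma> a ! j) \<le>
          exp (- Re (\<beta> ^ n * word_value \<gamma> (take j (\<sigma> a)))) * (?P n * exp (- V n (\<sigma> a ! j)))"
        by (intro mult_left_mono step) simp
      also have "\<dots> = ?P n * exp (- y j)"
        unfolding y_def minus_add_distrib exp_add by (simp only: mult_ac)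
      finally show "exp (- Re (\<beta> ^ n * word_value \<gamma> (take j (\<sigma> a)))) * ?Z n (\<sigma> a ! j) \<le> ?P n * exp (- y j)" .
    qed
    also have "\<dots> \<le> (\<Sum>j<length (\<sigma> a). ?P n * ((if j = i then E else 0) + E * exp (- g n)))"
    proof (intro sum_mono mult_left_mono P0)
      fix j assume j: "j \<in> {..<length (\<sigma> a)}"
      show "exp (- y j) \<le> (if j = i then E else 0) + E * exp (- g n)"
      proof (cases "j = i")
        case True
        have "exp (- y j) \<le> E" unfolding E_def using lower[of j a n] j by (simp add: y_def)
        moreover have "0 \<le> E * exp (- g n)" by (simp add: E_def)
        ultimately show ?thesis using True by simp
      next
        case False
        have "exp (- y j) \<le> exp (- V (Suc n) a + - g n)" using i[of j] j False by simp
        thus ?thesis using False by (simp add: E_def exp_add exp_diff exp_minus divide_inverse)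
      qed
    qed
    also have "\<dots> = ?P n * ((\<Sum>j<length (\<sigma> a). if j = i then E else 0) + real (length (\<sigma> a)) * (E * exp (- g n)))"
      by (simp add: sum_distrib_left[symmetric] sum.distrib)
    also have "\<dots> \<le> ?P n * (E + R * (E * exp (- g n)))"
    proof (intro mult_left_mono P0 add_mono mult_right_mono R)
      show "(\<Sum>j<length (\<sigma> a). if j = i then E else 0) \<le> E"
        by (simp add: E_def)
    qed (simp add: E_def)
    also have "\<dots> = ?P (Suc n) * E"
      using step(1) by (simp add: algebra_simps)
    finally show ?case unfolding E_def .
  qed
  define C where "C = C0 * exp (R * (\<Sum>n. exp (- g n)))"
  have "?P n \<le> C" for n
  proof -
    have "(\<Prod>k=N..<n. 1 + R * exp (- g k)) \<le> (\<Prod>k=N..<n. exp (R * exp (- g k)))"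
      using R0 by (intro prod_mono) (auto intro: add_nonneg_nonneg simp: exp_ge_add_one_self)
    also have "\<dots> = exp (R * (\<Sum>k=N..<n. exp (- g k)))"
      by (simp add: exp_sum sum_distrib_left)
    also have "\<dots> \<le> exp (R * (\<Sum>n. exp (- g n)))"
      using R0 summ by (auto intro!: mult_left_mono sum_le_suminf)
    finally show ?thesis unfolding C_def using C0_pos by simp
  qed
  hence "?P n * exp (- V n a) \<le> C * exp (- V n a)" for n a
    by (rule mult_right_mono) simp
  with main have "\<forall>n\<ge>N. \<forall>a. ?Z n a \<le> C * exp (- V n a)"
    using order_trans by blast
  moreover have "C > 0" using C0_pos by (simp add: C_def)
  ultimately show ?thesis by blast
qed

text \<open>Following an optimal label at every level descends to the empty prefix of a single letter, where
  the comparison with \<open>V 0\<close> costs a constant; no error is added on the way.\<close>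

lemma low_prefix:
  fixes V :: "nat \<Rightarrow> 'a::finite \<Rightarrow> real" and \<sigma> :: "'a \<Rightarrow> 'a list"
  assumes eig: "eigenvector_for (subst_matrix \<sigma>) \<beta> \<gamma>"
    and attained: "\<And>n a. \<exists>i<length (\<sigma> a).
      Re (\<beta> ^ n * word_value \<gamma> (take i (\<sigma> a))) + V n (\<sigma> a ! i) \<le> V (Suc n) a"
  shows "\<exists>B. \<forall>n a. \<exists>m<length ((subst_word \<sigma> ^^ n) [a]).
    Re (word_value \<gamma> (take m ((subst_word \<sigma> ^^ n) [a]))) \<le> V n a + B"
proof -
  define B where "B = Max (range (\<lambda>a. - V 0 a))"
  have B: "0 \<le> V 0 a + B" for a
  proof -
    have "- V 0 a \<le> B" unfolding B_def by (intro Max_ge) auto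
    thus ?thesis by simp
  qed
  have "\<exists>m<length ((subst_word \<sigma> ^^ n) [a]).
    Re (word_value \<gamma> (take m ((subst_word \<sigma> ^^ n) [a]))) \<le> V n a + B" for n a
  proof (induction n arbitrary: a)
    case 0
    show ?case using B by simp
  next
    case (Suc n)
    obtain i where i: "i < length (\<sigma> a)"
      "Re (\<beta> ^ n * word_value \<gamma> (take i (\<sigma> a))) + V n (\<sigma> a ! i) \<le> V (Suc n) a"
      using attained by blast
    let ?p = "(subst_word \<sigma> ^^ n) (take i (\<sigma> a))" and ?c = "(subst_word \<sigma> ^^ n) [\<sigma> a ! i]"
    obtain m where m: "m < length ?c" "Re (word_value \<gamma> (take m ?c)) \<le> V n (\<sigma> a ! i) + B"
      using Suc by blast
    have "\<sigma> a = take i (\<sigma> a) @ [\<sigma> a ! i] @ drop (Suc i) (\<sigma> a)"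
      using i(1) by (simp add: id_take_nth_drop[symmetric])
    hence split: "(subst_word \<sigma> ^^ Suc n) [a] = ?p @ ?c @ (subst_word \<sigma> ^^ n) (drop (Suc i) (\<sigma> a))"
      unfolding subst_word_power_Suc_single by (metis subst_word_power_append)
    show ?case
    proof (intro exI conjI)
      show "length ?p + m < length ((subst_word \<sigma> ^^ Suc n) [a])"
        unfolding split using m(1) by simp
      have "word_value \<gamma> (take (length ?p + m) ((subst_word \<sigma> ^^ Suc n) [a])) =
          \<beta> ^ n * word_value \<gamma> (take i (\<sigma> a)) + word_value \<gamma> (take m ?c)"
        unfolding split using m(1) by (simp add: word_value_subst_word_power[OF eig])
      thus "Re (word_value \<gamma> (take (length ?p + m) ((subst_word \<sigma> ^^ Suc n) [a]))) \<le> V (Suc n) a + B"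
        using i(2) m(2) by simp
    qed
  qed
  thus ?thesis by blast
qed

lemma support_min_scale:
  assumes "compact K" "K \<noteq> {}" "0 \<le> r"
  shows "support_min K (of_real r * \<tau>) = r * support_min K \<tau>"
proof (rule antisym)
  have eq: "Re (of_real r * \<tau> * z) = r * Re (\<tau> * z)" for z
    by (simp add: mult.assoc)
  obtain z where "z \<in> K" "Re (\<tau> * z) = support_min K \<tau>"
    using support_min_attained[OF assms(1,2)] .
  thus "support_min K (of_real r * \<tau>) \<le> r * support_min K \<tau>"
    using support_min_lower[OF assms(1), of z "of_real r * \<tau>"] eq by metis
  show "r * support_min K \<tau> \<le> support_min K (of_real r * \<tau>)"
    unfolding eq using assms
    by (intro support_min_greatest) (auto simp only: eq intro!: mult_left_mono support_min_lower)
qed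

text \<open>Since \<open>\<tau> / \<beta>\<close> replaces \<open>\<tau>\<close> under the contraction, directions of the form \<open>\<beta>\<^sup>n z\<close> without
  normalisation are carried to one another exactly.\<close>

lemma support_min_subfractal_step:
  fixes \<Gamma> :: "complex^'a::finite"
  assumes \<beta>: "cmod \<beta> > 1" and ne: "\<forall>a. \<sigma> a \<noteq> []" and e: "(p, c, s) \<in> labels \<sigma> a"
  shows "support_min (subfractal \<sigma> \<beta> \<Gamma> a (p, c, s)) (\<beta> ^ Suc n * z) =
    Re (\<beta> ^ n * word_value (z *s \<Gamma>) p) + support_min (fractal \<sigma> \<beta> \<Gamma> c) (\<beta> ^ n * z)"
proof -
  have "\<beta> ^ Suc n * z / \<beta> = \<beta> ^ n * z" using \<beta> by auto
  moreover have "\<beta> ^ n * z * word_value \<Gamma> p = \<beta> ^ n * word_value (z *s \<Gamma>) p"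
    by (simp add: word_value_scale)
  ultimately show ?thesis
    using support_min_image_affine[OF fractal_nonempty[OF ne] compact_fractal[OF \<beta>],
        where w = "word_value \<Gamma> p" and b = \<beta> and \<tau> = "\<beta> ^ Suc n * z"]
    unfolding subfractal_eq_image[OF \<beta> e] by metis
qed

lemma support_min_fractal_attained:
  fixes \<Gamma> :: "complex^'a::finite"
  assumes \<beta>: "cmod \<beta> > 1" and ne: "\<forall>a. \<sigma> a \<noteq> []"
  obtains e where "e \<in> labels \<sigma> a"
    "support_min (subfractal \<sigma> \<beta> \<Gamma> a e) \<tau> \<le> support_min (fractal \<sigma> \<beta> \<Gamma> a) \<tau>"
proof -
  obtain z where z: "z \<in> fractal \<sigma> \<beta> \<Gamma> a" "Re (\<tau> * z) = support_min (fractal \<sigma> \<beta> \<Gamma> a) \<tau>"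
    using support_min_attained[OF compact_fractal[OF \<beta>] fractal_nonempty[OF ne]] .
  then obtain e where e: "e \<in> labels \<sigma> a" "z \<in> subfractal \<sigma> \<beta> \<Gamma> a e"
    using fractal_eq_UN_subfractal by blast
  show ?thesis
    using that[OF e(1)] support_min_lower[OF compact_subfractal[OF \<beta> e(1)] e(2), of \<tau>] z(2) by simp
qed

lemma summable_exp_neg_geometric:
  fixes c \<rho> :: real
  assumes "0 < c" "1 < \<rho>"
  shows "summable (\<lambda>n. exp (- (c * \<rho> ^ n)))"
proof (rule summable_comparison_test')
  show "summable (\<lambda>n. exp (- (c * (\<rho> - 1))) ^ n)"
    using assms by (intro summable_geometric) simp
  fix n :: nat
  have "1 + real n * (\<rho> - 1) \<le> \<rho> ^ n"
    using Bernoulli_inequality[of "\<rho> - 1" n] assms by simp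
  hence "c * (real n * (\<rho> - 1)) \<le> c * \<rho> ^ n"
    using assms by (intro mult_left_mono) auto
  thus "norm (exp (- (c * \<rho> ^ n))) \<le> exp (- (c * (\<rho> - 1))) ^ n"
    by (simp add: exp_of_nat_mult[symmetric] mult_ac)
qed

section \<open>Renormalisation of orbits\<close>

text \<open>The point reached after all of \<open>w\<close> is left unconstrained, so that words concatenate.\<close>

definition follows :: "(real \<Rightarrow> real) \<Rightarrow> ('a \<Rightarrow> real set) \<Rightarrow> real \<Rightarrow> 'a list \<Rightarrow> bool"
  where "follows T J t w \<longleftrightarrow> (\<forall>i<length w. (T ^^ i) t \<in> J (w ! i))"

lemma follows_Nil [simp]: "follows T J t []"
  by (simp add: follows_def)

lemma follows_Cons: "follows T J t (a # w) \<longleftrightarrow> t \<in> J a \<and> follows T J (T t) w"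
  unfolding follows_def length_Cons All_less_Suc2
  by (simp only: funpow_0 funpow_Suc_right o_apply nth_Cons_0 nth_Cons_Suc)

lemma follows_append:
  "follows T J t (u @ v) \<longleftrightarrow> follows T J t u \<and> follows T J ((T ^^ length u) t) v"
proof (induction u arbitrary: t)
  case (Cons a u)
  have "(T ^^ length (a # u)) t = (T ^^ length u) (T t)"
    by (simp only: length_Cons funpow_Suc_right o_apply)
  with Cons show ?case by (simp only: append_Cons follows_Cons conj_assoc)
qed simp

lemma follows_single [simp]: "follows T J t [a] \<longleftrightarrow> t \<in> J a"
  by (simp add: follows_Cons)

lemma iem_interval_subset:
  assumes "iem T J" shows "J a \<subseteq> unit_Ico"
  using assms unfolding iem_def interval_partition_def by blast

lemma iem_maps_to:
  assumes "iem T J" "t \<in> unit_Ico" shows "T t \<in> unit_Ico"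
  using assms unfolding iem_def bij_betw_def by blast

lemma iem_covered:
  assumes "iem T J" "t \<in> unit_Ico" obtains a where "t \<in> J a"
  using assms unfolding iem_def interval_partition_def by blast

lemma renormalise_letter:
  assumes T: "iem T J" and self: "self_similar T \<alpha>" and sub: "associated_substitution T J \<alpha> \<sigma>" and v: "v \<in> J a"
  shows "follows T J (\<alpha> * v) (\<sigma> a)" and "(T ^^ length (\<sigma> a)) (\<alpha> * v) = \<alpha> * T v"
proof -
  have \<alpha>: "0 < \<alpha>" using self by (simp add: self_similar_def)
  have mem: "\<alpha> * v \<in> (*) \<alpha> ` J a" using v by blast
  show "follows T J (\<alpha> * v) (\<sigma> a)"
    unfolding follows_def using sub mem unfolding associated_substitution_def by blast
  have time: "first_return_time T {0..<\<alpha>} (\<alpha> * v) = length (\<sigma> a)"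
    using sub mem unfolding associated_substitution_def by blast
  have "v \<in> unit_Ico" using v iem_interval_subset[OF T] by blast
  hence "\<alpha> * v \<in> {0..<\<alpha>}" using \<alpha> by auto
  hence "first_return_map T {0..<\<alpha>} (\<alpha> * v) = \<alpha> * T (\<alpha> * v / \<alpha>)"
    using self unfolding self_similar_def by blast
  thus "(T ^^ length (\<sigma> a)) (\<alpha> * v) = \<alpha> * T v"
    using \<alpha> by (simp add: first_return_map_def time)
qed

text \<open>The orbit of \<open>\<alpha> v\<close> imitates that of \<open>v\<close>, spending the return time \<open>|\<sigma> a|\<close> on each letter
  \<open>a\<close>.\<close>

lemma renormalise_word:
  assumes T: "iem T J" and self: "self_similar T \<alpha>" and sub: "associated_substitution T J \<alpha> \<sigma>"
  shows "follows T J v w \<Longrightarrow> follows T J (\<alpha> * v) (subst_word \<sigma> w) \<and>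
    (T ^^ length (subst_word \<sigma> w)) (\<alpha> * v) = \<alpha> * (T ^^ length w) v"
proof (induction w rule: rev_induct)
  case Nil
  show ?case by (simp add: subst_word_def)
next
  case (snoc a w)
  hence *: "follows T J (\<alpha> * v) (subst_word \<sigma> w)"
      "(T ^^ length (subst_word \<sigma> w)) (\<alpha> * v) = \<alpha> * (T ^^ length w) v" "(T ^^ length w) v \<in> J a"
    by (simp_all add: follows_append)
  have [simp]: "subst_word \<sigma> [a] = \<sigma> a" by (simp add: subst_word_def)
  show ?case
    using * renormalise_letter[OF T self sub *(3)]
    by (simp add: follows_append funpow_add[of "length (\<sigma> a)"] add.commute[of _ "length (\<sigma> a)"])
qed

lemma renormalise_power:
  assumes T: "iem T J" and self: "self_similar T \<alpha>" and sub: "associated_substitution T J \<alpha> \<sigma>"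
    and "follows T J v w"
  shows "follows T J (\<alpha> ^ n * v) ((subst_word \<sigma> ^^ n) w) \<and>
    (T ^^ length ((subst_word \<sigma> ^^ n) w)) (\<alpha> ^ n * v) = \<alpha> ^ n * (T ^^ length w) v"
proof (induction n)
  case 0
  show ?case using assms(4) by simp
next
  case (Suc n)
  with renormalise_word[OF T self sub conjunct1[OF Suc]] show ?case
    by (simp add: mult.assoc)
qed

text \<open>The union \<open>U\<close> of the towers contains \<open>[0,\<alpha>)\<close>. It is mapped into itself because the top of each
  tower returns to \<open>[0,\<alpha>)\<close>, and a preimage of a point of \<open>U\<close> is in \<open>U\<close> because the first
  return map is onto \<open>[0,\<alpha>)\<close>. By minimality every two-sided orbit meets \<open>[0,\<alpha>)\<close>.\<close>

lemma towers_cover: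
  assumes T: "iem T J" and min: "minimal_map T" and self: "self_similar T \<alpha>"
    and sub: "associated_substitution T J \<alpha> \<sigma>" and t: "t \<in> unit_Ico"
  shows "\<exists>a v m. v \<in> J a \<and> m < length (\<sigma> a) \<and> t = (T ^^ m) (\<alpha> * v)"
proof -
  have \<alpha>: "0 < \<alpha>" "\<alpha> < 1" using self by (simp_all add: self_similar_def)
  have \<sigma>: "0 < length (\<sigma> a)" for a
    using sub unfolding associated_substitution_def length_greater_0_conv by metis
  define U where "U = {t. \<exists>a v m. v \<in> J a \<and> m < length (\<sigma> a) \<and> t = (T ^^ m) (\<alpha> * v)}"
  have UI: "(T ^^ m) (\<alpha> * v) \<in> U" if "v \<in> J a" "m < length (\<sigma> a)" for a v m
    unfolding U_def mem_Collect_eq using that by metis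
  have base: "\<alpha> * v \<in> U" if v: "v \<in> unit_Ico" for v
  proof -
    obtain a where "v \<in> J a" using iem_covered[OF T v] .
    from UI[OF this \<sigma>] show ?thesis by simp
  qed
  have "inj_on T unit_Ico" and surj: "T ` unit_Ico = unit_Ico"
    using T unfolding iem_def bij_betw_def by blast+
  note inj = inj_onD[OF this(1)]
  have fwd: "T s \<in> U" if sU: "s \<in> U" for s
  proof -
    obtain a v m where s: "v \<in> J a" "m < length (\<sigma> a)" "s = (T ^^ m) (\<alpha> * v)"
      using sU unfolding U_def by blast
    show ?thesis
    proof (cases "Suc m < length (\<sigma> a)")
      case True
      from UI[OF s(1) this] show ?thesis using s(3) by simp
    next
      case False
      hence "length (\<sigma> a) = Suc m" using s by simp
      hence "T s = \<alpha> * T v"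
        using renormalise_letter(2)[OF T self sub s(1)] s(3) by simp
      moreover have "T v \<in> unit_Ico"
        using s(1) iem_interval_subset[OF T] iem_maps_to[OF T] by blast
      ultimately show ?thesis using base by simp
    qed
  qed
  have bwd: "s \<in> U" if s: "s \<in> unit_Ico" "T s \<in> U" for s
  proof -
    have tower: "s \<in> U" if "v \<in> J a" "k < length (\<sigma> a)" "T s = T ((T ^^ k) (\<alpha> * v))" for a v k
    proof -
      have "(T ^^ k) (\<alpha> * v) \<in> unit_Ico"
        using renormalise_letter(1)[OF T self sub that(1)] that(2) iem_interval_subset[OF T]
        unfolding follows_def by blast
      hence "s = (T ^^ k) (\<alpha> * v)" using inj[OF that(3) s(1)] by simp
      thus ?thesis using UI[OF that(1,2)] by simp
    qed
    obtain a v m where m: "v \<in> J a" "m < length (\<sigma> a)" "T s = (T ^^ m) (\<alpha> * v)"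
      using s unfolding U_def by blast
    show ?thesis
    proof (cases m)
      case (Suc k)
      with m tower[of v a k] show ?thesis by simp
    next
      case 0
      have "v \<in> T ` unit_Ico"
        unfolding surj using m(1) iem_interval_subset[OF T] by blast
      then obtain v' where v': "v' \<in> unit_Ico" "v = T v'" by blast
      obtain b where b: "v' \<in> J b" using iem_covered[OF T v'(1)] .
      obtain k where k: "length (\<sigma> b) = Suc k" using \<sigma>[of b] gr0_conv_Suc by blast
      have "T s = T ((T ^^ k) (\<alpha> * v'))"
        using m(3) 0 v'(2) renormalise_letter(2)[OF T self sub b] k by simp
      with tower[OF b, of k] k show ?thesis by simp
    qed
  qed
  have fwd_pow: "(T ^^ n) s \<in> U" if "s \<in> U" for n s
    by (induction n) (use that fwd in \<open>simp_all\<close>)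
  have bwd_pow: "s \<in> unit_Ico \<Longrightarrow> (T ^^ n) s \<in> U \<Longrightarrow> s \<in> U" for n s
  proof (induction n arbitrary: s)
    case (Suc n)
    have "(T ^^ n) (T s) \<in> U"
      using Suc.prems(2) by (simp only: funpow_Suc_right o_apply)
    hence "T s \<in> U"
      by (rule Suc.IH[OF iem_maps_to[OF T Suc.prems(1)]])
    thus ?case by (rule bwd[OF Suc.prems(1)])
  qed simp
  have "\<alpha> / 2 \<in> closure (full_orbit T t)"
  proof -
    have "unit_Ico \<subseteq> closure (full_orbit T t)"
      using min t unfolding minimal_map_def by blast
    moreover have "\<alpha> / 2 \<in> unit_Ico" using \<alpha> by simp
    ultimately show ?thesis by blast
  qed
  then obtain s where s: "s \<in> full_orbit T t" "dist s (\<alpha> / 2) < \<alpha> / 2"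
    unfolding closure_approachable using half_gt_zero[OF \<alpha>(1)] by metis
  hence "0 < s" "s < \<alpha>" unfolding dist_real_def by linarith+
  hence "s \<in> U" using base[of "s / \<alpha>"] \<alpha> by (simp add: divide_less_eq)
  moreover obtain n where "s = (T ^^ n) t \<or> (T ^^ n) s = t"
    using s(1) unfolding full_orbit_def by blast
  ultimately have "t \<in> U" using bwd_pow[OF t, of n] fwd_pow[of s n] by auto
  thus ?thesis unfolding U_def by blast
qed

text \<open>A tower of level \<open>n + 1\<close> over \<open>b\<close> is a stack of towers of level \<open>n\<close>, restricted to narrower
  bottom floors, one over each letter of \<open>\<sigma> b\<close>.\<close>

lemma level_towers_cover:
  assumes T: "iem T J" and min: "minimal_map T" and self: "self_similar T \<alpha>"
    and sub: "associated_substitution T J \<alpha> \<sigma>"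
  shows "t \<in> unit_Ico \<Longrightarrow> \<exists>a v m. v \<in> J a \<and> m < length ((subst_word \<sigma> ^^ n) [a]) \<and> t = (T ^^ m) (\<alpha> ^ n * v)"
proof (induction n arbitrary: t)
  case 0
  thus ?case using iem_covered[OF T 0] by force
next
  case (Suc n)
  obtain a v m where m: "v \<in> J a" "m < length ((subst_word \<sigma> ^^ n) [a])" "t = (T ^^ m) (\<alpha> ^ n * v)"
    using Suc by blast
  have "v \<in> unit_Ico" using m(1) iem_interval_subset[OF T] by blast
  then obtain b u j where j: "u \<in> J b" "j < length (\<sigma> b)" "v = (T ^^ j) (\<alpha> * u)"
    using towers_cover[OF T min self sub] by blast
  have follows: "follows T J (\<alpha> * u) (\<sigma> b)"
    by (rule renormalise_letter(1)[OF T self sub j(1)])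
  hence "v \<in> J (\<sigma> b ! j)" using j unfolding follows_def by blast
  hence a: "\<sigma> b ! j = a"
    using m(1) T unfolding iem_def interval_partition_def disjoint_family_on_def by blast
  let ?p = "take j (\<sigma> b)"
  have split: "\<sigma> b = ?p @ [a] @ drop (Suc j) (\<sigma> b)"
    using id_take_nth_drop[OF j(2)] a by simp
  hence "follows T J (\<alpha> * u) ?p" using follows by (metis follows_append)
  from renormalise_power[OF T self sub this, of n]
  have "(T ^^ length ((subst_word \<sigma> ^^ n) ?p)) (\<alpha> ^ Suc n * u) = \<alpha> ^ n * v"
    using j by (simp add: mult_ac)
  hence "t = (T ^^ (m + length ((subst_word \<sigma> ^^ n) ?p))) (\<alpha> ^ Suc n * u)"
    using m(3) by (simp add: funpow_add)
  moreover have "(subst_word \<sigma> ^^ Suc n) [b] =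
      (subst_word \<sigma> ^^ n) ?p @ (subst_word \<sigma> ^^ n) [a] @ (subst_word \<sigma> ^^ n) (drop (Suc j) (\<sigma> b))"
    unfolding subst_word_power_Suc_single using split by (metis subst_word_power_append)
  hence "m + length ((subst_word \<sigma> ^^ n) ?p) < length ((subst_word \<sigma> ^^ Suc n) [b])"
    using m(2) by simp
  ultimately show ?case using j(1) by blast
qed

lemma iem_power_translation:
  assumes T: "iem T J" and "follows T J s w" "follows T J t w" "m \<le> length w"
  shows "(T ^^ m) s - (T ^^ m) t = s - t"
  using assms(4)
proof (induction m)
  case (Suc m)
  obtain \<delta> :: "real^'a" where \<delta>: "\<And>a t. t \<in> J a \<Longrightarrow> T t = t + \<delta> $ a"
    using T unfolding iem_def by blast
  have "(T ^^ m) s \<in> J (w ! m)" "(T ^^ m) t \<in> J (w ! m)"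
    using assms(2,3) Suc.prems unfolding follows_def by auto
  with \<delta> Suc show ?case by simp
qed simp

lemma affine_power_slope:
  fixes \<gamma> :: "complex^'a::finite"
  assumes f: "\<And>t. t \<in> unit_Ico \<Longrightarrow> f t \<in> unit_Ico"
    and conj: "affine_semiconjugacy T J (\<chi> a. exp (- Re (\<gamma> $ a))) f h"
    and p: "p \<in> unit_Ico" "follows T J (h p) w" and q: "q \<in> unit_Ico" "follows T J (h q) w"
  shows "m \<le> length w \<Longrightarrow> (f ^^ m) p \<in> unit_Ico \<and> h ((f ^^ m) p) = (T ^^ m) (h p) \<and>
    (f ^^ m) q \<in> unit_Ico \<and> h ((f ^^ m) q) = (T ^^ m) (h q) \<and>
    (f ^^ m) p - (f ^^ m) q = exp (- Re (word_value \<gamma> (take m w))) * (p - q)"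
proof (induction m)
  case 0
  show ?case using p q by simp
next
  case (Suc m)
  hence m: "m < length w" by simp
  let ?a = "w ! m"
  have semi: "\<And>t. t \<in> unit_Ico \<Longrightarrow> h (f t) = T (h t)"
    using conj unfolding affine_semiconjugacy_def by blast
  have "\<forall>a. has_slope_on f ((\<chi> a. exp (- Re (\<gamma> $ a))) $ a) {t \<in> unit_Ico. h t \<in> J a}"
    using conj unfolding affine_semiconjugacy_def by blast
  from this[rule_format, of ?a]
  obtain d where d: "\<And>t. t \<in> unit_Ico \<Longrightarrow> h t \<in> J ?a \<Longrightarrow> f t = exp (- Re (\<gamma> $ ?a)) * t + d"
    unfolding has_slope_on_def by auto
  have IH: "(f ^^ m) p \<in> unit_Ico" "h ((f ^^ m) p) = (T ^^ m) (h p)"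
    "(f ^^ m) q \<in> unit_Ico" "h ((f ^^ m) q) = (T ^^ m) (h q)"
    "(f ^^ m) p - (f ^^ m) q = exp (- Re (word_value \<gamma> (take m w))) * (p - q)"
    using Suc.IH m by auto
  have J: "(T ^^ m) (h p) \<in> J ?a" "(T ^^ m) (h q) \<in> J ?a"
    using p q m unfolding follows_def by auto
  have "(f ^^ Suc m) p - (f ^^ Suc m) q = exp (- Re (\<gamma> $ ?a)) * ((f ^^ m) p - (f ^^ m) q)"
    using d[OF IH(1)] d[OF IH(3)] J IH(2,4) by (simp add: right_diff_distrib)
  also have "\<dots> = exp (- Re (word_value \<gamma> (take (Suc m) w))) * (p - q)"
    unfolding IH(5) take_Suc_conv_app_nth[OF m] word_value_append word_value_single
      plus_complex.sel minus_add_distrib exp_add by (simp only: mult_ac)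
  finally show ?case
    using IH f[OF IH(1)] f[OF IH(3)] semi[OF IH(1)] semi[OF IH(3)] by simp
qed

text \<open>Extending the inverse by the identity outside \<open>[0,1)\<close> gives a monotone surjection of the line,
  which is continuous, hence uniformly continuous on the compact interval \<open>[0,1]\<close>. Working on
  \<open>[0,1]\<close> matters: it rules out loss of uniformity near the missing endpoint.\<close>

lemma increasing_bijection_inverse_modulus:
  assumes bij: "bij_betw h unit_Ico unit_Ico" and mono: "mono_on unit_Ico h" and "0 < \<epsilon>"
  shows "\<exists>\<delta>>0. \<forall>p\<in>unit_Ico. \<forall>q\<in>unit_Ico. \<bar>h p - h q\<bar> < \<delta> \<longrightarrow> \<bar>p - q\<bar> < \<epsilon>"
proof -
  define g where "g = inv_into unit_Ico h"
  have g: "g y \<in> unit_Ico" "h (g y) = y" if "y \<in> unit_Ico" for y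
    using bij that unfolding g_def bij_betw_def by (metis inv_into_into, metis f_inv_into_f)
  have gh: "g (h p) = p" if "p \<in> unit_Ico" for p
    using bij that unfolding g_def bij_betw_def by (metis inv_into_f_f)
  \<comment> \<open>The extension has range \<open>UNIV\<close>, which is open; monotone maps with open range are continuous.\<close>
  define G where "G y = (if y \<in> unit_Ico then g y else y)" for y
  have G_in: "G y \<in> unit_Ico \<longleftrightarrow> y \<in> unit_Ico" for y
    unfolding G_def using g(1) by auto
  have "range G = UNIV"
  proof (intro set_eqI iffI UNIV_I)
    fix x :: real
    show "x \<in> range G"
    proof (cases "x \<in> unit_Ico")
      case True
      hence "h x \<in> unit_Ico" using bij unfolding bij_betw_def by blast
      hence "G (h x) = x" using gh[OF True] unfolding G_def by simp
      thus ?thesis by (metis rangeI)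
    next
      case False
      hence "G x = x" unfolding G_def by (rule if_not_P)
      thus ?thesis by (metis rangeI)
    qed
  qed
  moreover have "G x \<le> G y" if "x \<le> y" for x y
  proof (cases "x \<in> unit_Ico \<and> y \<in> unit_Ico")
    case True
    show ?thesis
    proof (rule ccontr)
      assume "\<not> G x \<le> G y"
      hence less: "g y \<le> g x" "g y \<noteq> g x" using True by (auto simp: G_def)
      have "h (g y) \<le> h (g x)"
        using True by (intro mono_onD[OF mono g(1) g(1) less(1)]) auto
      hence "y = x" using g True that by auto
      thus False using less by simp
    qed
  next
    case False
    show ?thesis
      using G_in[of x] G_in[of y] that False by (auto simp: G_def split: if_splits)
  qed
  ultimately have "continuous_on UNIV G"
    by (intro continuous_onI_mono) auto
  hence "uniformly_continuous_on {0..1} G"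
    by (intro compact_uniformly_continuous) (auto intro: continuous_on_subset)
  then obtain \<delta> where \<delta>: "\<delta> > 0" "\<And>x y. x \<in> {0..1} \<Longrightarrow> y \<in> {0..1} \<Longrightarrow> dist y x < \<delta> \<Longrightarrow> dist (G y) (G x) < \<epsilon>"
    unfolding uniformly_continuous_on_def using assms(3) by metis
  have "\<bar>p - q\<bar> < \<epsilon>" if "p \<in> unit_Ico" "q \<in> unit_Ico" "\<bar>h p - h q\<bar> < \<delta>" for p q
  proof -
    have "h p \<in> unit_Ico" "h q \<in> unit_Ico" using bij that unfolding bij_betw_def by blast+
    moreover from this have "G (h p) = p" "G (h q) = q" using gh that by (auto simp: G_def)
    ultimately show ?thesis using \<delta>(2)[of "h q" "h p"] that(3) by (auto simp: dist_real_def)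
  qed
  thus ?thesis using \<delta>(1) by blast
qed

text \<open>Each \<open>S i\<close> lies in the closed interval of length \<open>d i\<close> that starts at its infimum, and Lebesgue
  measure is subadditive.\<close>

lemma unit_interval_cover_total:
  assumes I: "finite I" and cover: "unit_Ico \<subseteq> (\<Union>i\<in>I. S i)"
    and diam: "\<And>i x y. i \<in> I \<Longrightarrow> x \<in> S i \<Longrightarrow> y \<in> S i \<Longrightarrow> \<bar>x - y\<bar> \<le> d i"
    and d: "\<And>i. i \<in> I \<Longrightarrow> 0 \<le> d i"
  shows "1 \<le> (\<Sum>i\<in>I. d i)"
proof -
  let ?c = "\<lambda>i. {Inf (S i)..Inf (S i) + d i}"
  have "S i \<subseteq> ?c i" if i: "i \<in> I" for i
  proof
    fix x assume x: "x \<in> S i"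
    have lb: "x - d i \<le> y" if "y \<in> S i" for y
      using diam[OF i x that] by linarith
    hence "bdd_below (S i)" by (rule bdd_belowI)
    hence "Inf (S i) \<le> x" using x by (intro cInf_lower)
    moreover have "x - d i \<le> Inf (S i)" using x lb by (intro cInf_greatest) auto
    ultimately show "x \<in> ?c i" by simp
  qed
  hence "unit_Ico \<subseteq> (\<Union>i\<in>I. ?c i)" using cover by blast
  moreover have "(\<Union>i\<in>I. ?c i) \<in> fmeasurable lborel"
    by (intro fmeasurable.finite_UN I fmeasurable_compact) auto
  ultimately have "measure lborel unit_Ico \<le> measure lborel (\<Union>i\<in>I. ?c i)"
    by (intro measure_mono_fmeasurable) auto
  also have "\<dots> \<le> (\<Sum>i\<in>I. measure lborel (?c i))"
    by (intro measure_UNION_le I) auto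
  also have "\<dots> = (\<Sum>i\<in>I. d i)"
    using d by (intro sum.cong) auto
  finally show ?thesis by simp
qed

section \<open>Absence of conjugate affine extensions\<close>

text \<open>The gap of order \<open>A\<^sup>-\<^sup>n\<close> between support values in unit directions is multiplied by the modulus
  \<open>|z| |\<beta>|\<^sup>n\<close> of \<open>z \<beta>\<^sup>n\<close>. It thus becomes the exponentially growing \<open>g\<close> required in
  \<open>prefix_weight_bound\<close>.\<close>

lemma renormalised_sums:
  fixes \<Gamma> \<gamma> :: "complex^'a::finite"
  assumes \<beta>: "cmod \<beta> > 1" and ne: "\<forall>a. \<sigma> a \<noteq> []" and urp: "unique_representation \<sigma> \<beta> \<Gamma>"
    and good: "good_eigenvector \<sigma> \<beta> \<Gamma> \<gamma>"
  obtains V :: "nat \<Rightarrow> 'a \<Rightarrow> real" and B C :: real and N :: nat where "C > 0"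
    "\<And>n a. N \<le> n \<Longrightarrow> prefix_weight \<gamma> ((subst_word \<sigma> ^^ n) [a]) \<le> C * exp (- V n a)"
    "\<And>n a. \<exists>m<length ((subst_word \<sigma> ^^ n) [a]).
      Re (word_value \<gamma> (take m ((subst_word \<sigma> ^^ n) [a]))) \<le> V n a + B"
proof -
  obtain z where eig: "eigenvector_for (subst_matrix \<sigma>) \<beta> \<gamma>" and z: "z \<noteq> 0"
    and \<gamma>: "\<gamma> = z *s \<Gamma>" and dir: "good_direction \<sigma> \<beta> \<Gamma> (unit_part z)"
    using good unfolding good_eigenvector_def by blast
  obtain A \<kappa> where A: "1 < A" "A < cmod \<beta>" and \<kappa>: "\<kappa> > 0" and
    ev: "\<forall>\<^sub>F k in sequentially. \<forall>a. \<exists>e\<in>labels \<sigma> a. \<forall>e'\<in>labels \<sigma> a. e' \<noteq> e \<longrightarrow>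
      support_min (fractal \<sigma> \<beta> \<Gamma> a) (unit_part \<beta> ^ k * unit_part z) + \<kappa> / A ^ k
        \<le> support_min (subfractal \<sigma> \<beta> \<Gamma> a e') (unit_part \<beta> ^ k * unit_part z)"
    using eventually_label_gap[OF \<beta> ne urp dir] by blast
  obtain N where N: "\<And>k a. N \<le> k \<Longrightarrow> \<exists>e\<in>labels \<sigma> a. \<forall>e'\<in>labels \<sigma> a. e' \<noteq> e \<longrightarrow>
      support_min (fractal \<sigma> \<beta> \<Gamma> a) (unit_part \<beta> ^ k * unit_part z) + \<kappa> / A ^ k
        \<le> support_min (subfractal \<sigma> \<beta> \<Gamma> a e') (unit_part \<beta> ^ k * unit_part z)"
    using ev unfolding eventually_sequentially by blast
  define V where "V n a = support_min (fractal \<sigma> \<beta> \<Gamma> a) (\<beta> ^ n * z)" for n a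
  define lab where "lab a i = (take i (\<sigma> a), \<sigma> a ! i, drop (Suc i) (\<sigma> a))" for a i
  have labs: "labels \<sigma> a = lab a ` {..<length (\<sigma> a)}" for a
    unfolding lab_def by (rule labels_conv_image)
  have step: "support_min (subfractal \<sigma> \<beta> \<Gamma> a (lab a i)) (\<beta> ^ Suc n * z) =
      Re (\<beta> ^ n * word_value \<gamma> (take i (\<sigma> a))) + V n (\<sigma> a ! i)" if "i < length (\<sigma> a)" for a i n
  proof -
    have "lab a i \<in> labels \<sigma> a" unfolding labs using that by blast
    thus ?thesis
      unfolding lab_def V_def \<gamma> by (rule support_min_subfractal_step[OF \<beta> ne])
  qed
  have lower: "V (Suc n) a \<le> Re (\<beta> ^ n * word_value \<gamma> (take i (\<sigma> a))) + V n (\<sigma> a ! i)"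
    if i: "i < length (\<sigma> a)" for n a i
  proof -
    have e: "lab a i \<in> labels \<sigma> a" unfolding labs using i by blast
    hence "subfractal \<sigma> \<beta> \<Gamma> a (lab a i) \<subseteq> fractal \<sigma> \<beta> \<Gamma> a"
      unfolding fractal_eq_UN_subfractal by blast
    from support_min_mono[OF compact_fractal[OF \<beta>] this subfractal_nonempty[OF \<beta> ne e]]
    show ?thesis
      unfolding step[OF i, symmetric] by (simp only: V_def)
  qed
  have attained: "\<exists>i<length (\<sigma> a). Re (\<beta> ^ n * word_value \<gamma> (take i (\<sigma> a))) + V n (\<sigma> a ! i) \<le> V (Suc n) a"
    for n a
  proof -
    obtain e where e: "e \<in> labels \<sigma> a"
      "support_min (subfractal \<sigma> \<beta> \<Gamma> a e) (\<beta> ^ Suc n * z) \<le> V (Suc n) a"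
      unfolding V_def using support_min_fractal_attained[OF \<beta> ne] .
    then obtain i where "i < length (\<sigma> a)" "e = lab a i" unfolding labs by blast
    with e(2) step show ?thesis by auto
  qed
  define c where "c = \<kappa> * cmod z * (cmod \<beta> / A)"
  define g where "g n = c * (cmod \<beta> / A) ^ n" for n
  have direction: "\<beta> ^ n * z = of_real (cmod \<beta> ^ n * cmod z) * (unit_part \<beta> ^ n * unit_part z)" for n
  proof -
    have "\<beta> \<noteq> 0" using \<beta> by auto
    thus ?thesis using z by (simp add: unit_part_def power_divide)
  qed
  have gap: "\<exists>i. \<forall>j<length (\<sigma> a). j \<noteq> i \<longrightarrow>
      V (Suc n) a + g n \<le> Re (\<beta> ^ n * word_value \<gamma> (take j (\<sigma> a))) + V n (\<sigma> a ! j)"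
    if n: "N \<le> n" for n a
  proof -
    let ?\<tau> = "unit_part \<beta> ^ Suc n * unit_part z" and ?r = "cmod \<beta> ^ Suc n * cmod z"
    obtain e where "e \<in> labels \<sigma> a" and e: "\<And>e'. e' \<in> labels \<sigma> a \<Longrightarrow> e' \<noteq> e \<Longrightarrow>
        support_min (fractal \<sigma> \<beta> \<Gamma> a) ?\<tau> + \<kappa> / A ^ Suc n \<le> support_min (subfractal \<sigma> \<beta> \<Gamma> a e') ?\<tau>"
      using N[of "Suc n" a] n by auto
    then obtain i where i: "i < length (\<sigma> a)" "e = lab a i" unfolding labs by blast
    have "V (Suc n) a + g n \<le> Re (\<beta> ^ n * word_value \<gamma> (take j (\<sigma> a))) + V n (\<sigma> a ! j)"
      if j: "j < length (\<sigma> a)" "j \<noteq> i" for j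
    proof -
      have e': "lab a j \<in> labels \<sigma> a" unfolding labs using j by blast
      \<comment> \<open>Labels of one letter are told apart by the lengths of their prefixes.\<close>
      have "length (fst (lab a j)) \<noteq> length (fst e)"
        using i j by (simp add: lab_def)
      hence distinct: "lab a j \<noteq> e" by blast
      have r: "0 \<le> ?r" by simp
      have "?r * (support_min (fractal \<sigma> \<beta> \<Gamma> a) ?\<tau> + \<kappa> / A ^ Suc n) \<le>
          ?r * support_min (subfractal \<sigma> \<beta> \<Gamma> a (lab a j)) ?\<tau>"
        by (intro mult_left_mono e e' distinct r)
      moreover have "?r * (\<kappa> / A ^ Suc n) = g n"
        using A by (simp add: g_def c_def power_divide)
      moreover have "?r * support_min (fractal \<sigma> \<beta> \<Gamma> a) ?\<tau> = V (Suc n) a"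
        unfolding V_def direction
        by (rule support_min_scale[OF compact_fractal[OF \<beta>] fractal_nonempty[OF ne] r, symmetric])
      moreover have "?r * support_min (subfractal \<sigma> \<beta> \<Gamma> a (lab a j)) ?\<tau> =
          Re (\<beta> ^ n * word_value \<gamma> (take j (\<sigma> a))) + V n (\<sigma> a ! j)"
        unfolding step[OF j(1), symmetric] direction
        by (rule support_min_scale[OF compact_subfractal[OF \<beta> e'] subfractal_nonempty[OF \<beta> ne e'] r, symmetric])
      ultimately show ?thesis by (simp add: distrib_left)
    qed
    thus ?thesis by blast
  qed
  have "summable (\<lambda>n. exp (- g n))"
    unfolding g_def
  proof (rule summable_exp_neg_geometric)
    show "0 < c"
      unfolding c_def using \<kappa> z A \<beta> by (intro mult_pos_pos divide_pos_pos) auto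
    show "1 < cmod \<beta> / A" using A by simp
  qed
  from prefix_weight_bound[OF eig lower gap this]
  obtain C where "C > 0" "\<And>n a. N \<le> n \<Longrightarrow> prefix_weight \<gamma> ((subst_word \<sigma> ^^ n) [a]) \<le> C * exp (- V n a)"
    by blast
  moreover obtain B where "\<And>n a. \<exists>m<length ((subst_word \<sigma> ^^ n) [a]).
      Re (word_value \<gamma> (take m ((subst_word \<sigma> ^^ n) [a]))) \<le> V n a + B"
    using low_prefix[OF eig attained] by blast
  ultimately show ?thesis by (rule that)
qed

text \<open>By uniform continuity every floor is shorter than \<open>\<epsilon>\<close>, in particular the one over \<open>a\<close> whose
  prefix has \<open>\<gamma>\<close>-value with real part at most \<open>V n a + B\<close>; this bounds
  the bottom floor \<open>K a\<close> by \<open>D a\<close>. The bound on the sums then makes the whole tower shorter than a constant times \<open>\<epsilon>\<close>.\<close>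

lemma no_conjugate_of_bounded_sums:
  fixes \<gamma> :: "complex^'a::finite" and V :: "nat \<Rightarrow> 'a \<Rightarrow> real"
  assumes T: "iem T J" and min: "minimal_map T" and self: "self_similar T \<alpha>"
    and sub: "associated_substitution T J \<alpha> \<sigma>"
    and C: "C > 0"
    and weight: "\<And>n a. N \<le> n \<Longrightarrow> prefix_weight \<gamma> ((subst_word \<sigma> ^^ n) [a]) \<le> C * exp (- V n a)"
    and low: "\<And>n a. \<exists>m<length ((subst_word \<sigma> ^^ n) [a]).
      Re (word_value \<gamma> (take m ((subst_word \<sigma> ^^ n) [a]))) \<le> V n a + B"
    and f: "\<And>t. t \<in> unit_Ico \<Longrightarrow> f t \<in> unit_Ico"
    and conj: "affine_semiconjugacy T J (\<chi> a. exp (- Re (\<gamma> $ a))) f h"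
    and inj: "inj_on h unit_Ico"
  shows False
proof -
  let ?w = "\<lambda>n a. (subst_word \<sigma> ^^ n) [a]"
  have \<alpha>: "0 < \<alpha>" "\<alpha> < 1" using self by (simp_all add: self_similar_def)
  have h: "h ` unit_Ico = unit_Ico" "mono_on unit_Ico h"
    using conj unfolding affine_semiconjugacy_def by blast+
  define c where "c = real CARD('a) * (exp B * C)"
  have c: "c > 0" using C by (simp add: c_def)
  \<comment> \<open>The towers will have total length at most \<open>\<epsilon> c\<close>, which this choice makes \<open>1/2\<close>.\<close>
  define \<epsilon> where "\<epsilon> = 1 / (2 * c)"
  have \<epsilon>: "\<epsilon> > 0" using c by (simp add: \<epsilon>_def)
  obtain \<delta> where \<delta>: "\<delta> > 0" "\<And>p q. p \<in> unit_Ico \<Longrightarrow> q \<in> unit_Ico \<Longrightarrow> \<bar>h p - h q\<bar> < \<delta> \<Longrightarrow> \<bar>p - q\<bar> < \<epsilon>"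
    using increasing_bijection_inverse_modulus[OF bij_betw_imageI[OF inj h(1)] h(2) \<epsilon>] by blast
  have "(\<lambda>n. \<alpha> ^ n) \<longlonglongrightarrow> 0" using \<alpha> by (intro LIMSEQ_realpow_zero) auto
  hence "\<forall>\<^sub>F n in sequentially. \<alpha> ^ n < \<delta>" using \<delta>(1) by (rule order_tendstoD)
  then obtain n0 where n0: "\<And>n. n0 \<le> n \<Longrightarrow> \<alpha> ^ n < \<delta>" unfolding eventually_sequentially by blast
  define n where "n = max n0 N"
  have n: "\<alpha> ^ n < \<delta>" "N \<le> n" using n0 by (auto simp: n_def)
  define K where "K a = {p \<in> unit_Ico. h p \<in> (*) (\<alpha> ^ n) ` J a}" for a
  define D where "D a = \<epsilon> * exp (V n a + B)" for a
  have K_follows: "follows T J (h p) (?w n a)" if "p \<in> K a" for p a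
  proof -
    obtain v where v: "v \<in> J a" "h p = \<alpha> ^ n * v" using \<open>p \<in> K a\<close> unfolding K_def by blast
    hence "follows T J v [a]" by simp
    from renormalise_power[OF T self sub this, of n] v(2) show ?thesis by simp
  qed
  have K_close: "\<bar>h p - h q\<bar> < \<delta>" if pq: "p \<in> K a" "q \<in> K a" for p q a
  proof -
    obtain u v where uv: "u \<in> J a" "v \<in> J a" "h p = \<alpha> ^ n * u" "h q = \<alpha> ^ n * v"
      using pq unfolding K_def by blast
    hence "u \<in> unit_Ico" "v \<in> unit_Ico" using iem_interval_subset[OF T] by blast+
    hence "\<bar>u - v\<bar> \<le> 1" by auto
    hence "\<alpha> ^ n * \<bar>u - v\<bar> \<le> \<alpha> ^ n" using \<alpha> by (simp add: mult_left_le)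
    moreover have "\<bar>h p - h q\<bar> = \<alpha> ^ n * \<bar>u - v\<bar>"
      unfolding uv right_diff_distrib[symmetric] abs_mult using \<alpha> by simp
    ultimately show ?thesis using n(1) by linarith
  qed
  have small: "exp (- Re (word_value \<gamma> (take m (?w n a)))) * \<bar>p - q\<bar> < \<epsilon>"
    if pq: "p \<in> K a" "q \<in> K a" and m: "m < length (?w n a)" for p q a m
  proof -
    have I: "p \<in> unit_Ico" "q \<in> unit_Ico" using pq by (auto simp: K_def)
    note fol = K_follows[OF pq(1)] K_follows[OF pq(2)]
    note slope = affine_power_slope[OF f conj I(1) fol(1) I(2) fol(2) less_imp_le[OF m]]
    have "\<bar>h ((f ^^ m) p) - h ((f ^^ m) q)\<bar> < \<delta>"
      using slope iem_power_translation[OF T fol less_imp_le[OF m]] K_close[OF pq] by simp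
    hence "\<bar>(f ^^ m) p - (f ^^ m) q\<bar> < \<epsilon>" using \<delta>(2) slope by blast
    moreover have "\<bar>(f ^^ m) p - (f ^^ m) q\<bar> = exp (- Re (word_value \<gamma> (take m (?w n a)))) * \<bar>p - q\<bar>"
      using slope by (simp add: abs_mult)
    ultimately show ?thesis by simp
  qed
  have K_diam: "\<bar>p - q\<bar> \<le> D a" if pq: "p \<in> K a" "q \<in> K a" for p q a
  proof -
    obtain m where m: "m < length (?w n a)" "Re (word_value \<gamma> (take m (?w n a))) \<le> V n a + B"
      using low by blast
    let ?S = "Re (word_value \<gamma> (take m (?w n a)))"
    have "\<bar>p - q\<bar> = exp ?S * (exp (- ?S) * \<bar>p - q\<bar>)"
      by (simp add: exp_minus)
    also have "\<dots> \<le> exp (V n a + B) * \<epsilon>"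
      using small[OF pq m(1)] m(2) by (intro mult_mono) auto
    finally show ?thesis by (simp add: D_def mult.commute)
  qed
  let ?I = "SIGMA a:UNIV. {..<length (?w n a)}"
  let ?d = "\<lambda>(a, m). exp (- Re (word_value \<gamma> (take m (?w n a)))) * D a"
  have "1 \<le> (\<Sum>i\<in>?I. ?d i)"
  proof (rule unit_interval_cover_total[where S = "\<lambda>(a, m). (f ^^ m) ` K a"])
    show "unit_Ico \<subseteq> (\<Union>i\<in>?I. (\<lambda>(a, m). (f ^^ m) ` K a) i)"
    proof
      fix t :: real assume t: "t \<in> unit_Ico"
      hence "h t \<in> unit_Ico" using h(1) by blast
      then obtain a v m where v: "v \<in> J a" "m < length (?w n a)" "h t = (T ^^ m) (\<alpha> ^ n * v)"
        using level_towers_cover[OF T min self sub, of "h t" n] by blast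
      have vI: "v \<in> unit_Ico" using v(1) iem_interval_subset[OF T] by blast
      hence "\<alpha> ^ n * v \<in> unit_Ico"
        using \<alpha> mult_le_one[of "\<alpha> ^ n" v] power_le_one[of \<alpha> n] mult_left_le_one_le[of v "\<alpha> ^ n"] by auto
      then obtain p where p: "p \<in> unit_Ico" "h p = \<alpha> ^ n * v" using h(1) by (metis imageE)
      have pK: "p \<in> K a" using p v(1) unfolding K_def by blast
      have "(f ^^ m) p \<in> unit_Ico" "h ((f ^^ m) p) = (T ^^ m) (h p)"
        using affine_power_slope[OF f conj p(1) K_follows[OF pK] p(1) K_follows[OF pK] less_imp_le[OF v(2)]] by auto
      hence "t = (f ^^ m) p" using inj_onD[OF inj _ t] v(3) p(2) by simp
      thus "t \<in> (\<Union>i\<in>?I. (\<lambda>(a, m). (f ^^ m) ` K a) i)"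
        using v(2) pK by (intro UN_I[of "(a, m)"]) auto
    qed
    show "\<bar>x - y\<bar> \<le> ?d i"
      if i: "i \<in> ?I" and xy: "x \<in> (\<lambda>(a, m). (f ^^ m) ` K a) i" "y \<in> (\<lambda>(a, m). (f ^^ m) ` K a) i" for i x y
    proof -
      obtain a m where am: "i = (a, m)" "m < length (?w n a)" using i by blast
      obtain p q where pq: "p \<in> K a" "q \<in> K a" "x = (f ^^ m) p" "y = (f ^^ m) q" using xy am by auto
      have I: "p \<in> unit_Ico" "q \<in> unit_Ico" using pq by (auto simp: K_def)
      have "x - y = exp (- Re (word_value \<gamma> (take m (?w n a)))) * (p - q)"
        using affine_power_slope[OF f conj I(1) K_follows[OF pq(1)] I(2) K_follows[OF pq(2)] less_imp_le[OF am(2)]]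
        unfolding pq by blast
      hence "\<bar>x - y\<bar> = exp (- Re (word_value \<gamma> (take m (?w n a)))) * \<bar>p - q\<bar>"
        by (simp add: abs_mult)
      thus ?thesis using K_diam[OF pq(1,2)] am(1) by simp
    qed
  qed (use \<epsilon> in \<open>auto simp: D_def\<close>)
  also have "(\<Sum>i\<in>?I. ?d i) = (\<Sum>a\<in>UNIV. \<Sum>m<length (?w n a). exp (- Re (word_value \<gamma> (take m (?w n a)))) * D a)"
    by (subst sum.Sigma) auto
  also have "\<dots> = (\<Sum>a\<in>UNIV. prefix_weight \<gamma> (?w n a) * D a)"
    unfolding prefix_weight_def sum_distrib_right ..
  also have "\<dots> \<le> (\<Sum>a\<in>(UNIV :: 'a set). \<epsilon> * (exp B * C))"
  proof (rule sum_mono)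
    fix a
    have "prefix_weight \<gamma> (?w n a) * D a \<le> (C * exp (- V n a)) * D a"
      using \<epsilon> by (intro mult_right_mono weight n) (simp add: D_def)
    also have "\<dots> = \<epsilon> * (exp B * C)"
      by (simp add: D_def exp_add exp_minus)
    finally show "prefix_weight \<gamma> (?w n a) * D a \<le> \<epsilon> * (exp B * C)" .
  qed
  also have "\<dots> = \<epsilon> * c" by (simp add: c_def)
  also have "\<dots> = 1 / 2" using c by (simp add: \<epsilon>_def)
  finally show False by simp
qed

theorem theorem3p6:
  fixes T :: "real \<Rightarrow> real" and J :: "'a::finite \<Rightarrow> real set" and \<alpha> :: real
    and \<sigma> :: "'a \<Rightarrow> 'a list" and \<beta> :: complex and \<Gamma> \<gamma> :: "complex^'a"
  assumes "iem T J"
    and "minimal_map T"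
    and "self_similar T \<alpha>"
    and "associated_substitution T J \<alpha> \<sigma>"
    and "primitive_subst \<sigma>"
    and "cmod \<beta> > 1"
    and "\<not> (\<exists>n>0. unit_part \<beta> ^ n = 1)"
    and "eigenvector_for (subst_matrix \<sigma>) \<beta> \<Gamma>"
    and "unique_representation \<sigma> \<beta> \<Gamma>"
    and "good_eigenvector \<sigma> \<beta> \<Gamma> \<gamma>"
  shows "\<not> (\<exists>f. affine_extension T J (\<chi> a. exp (- Re (\<gamma> $ a))) f \<and>
                affine_conjugate T J (\<chi> a. exp (- Re (\<gamma> $ a))) f)"
proof
  assume "\<exists>f. affine_extension T J (\<chi> a. exp (- Re (\<gamma> $ a))) f \<and>
    affine_conjugate T J (\<chi> a. exp (- Re (\<gamma> $ a))) f"
  then obtain f h where aff: "affine_iem f (\<chi> a. exp (- Re (\<gamma> $ a)))"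
    and conj: "affine_semiconjugacy T J (\<chi> a. exp (- Re (\<gamma> $ a))) f h" and inj: "inj_on h unit_Ico"
    unfolding affine_extension_def affine_conjugate_def by blast
  have f: "f t \<in> unit_Ico" if "t \<in> unit_Ico" for t
    using aff that unfolding affine_iem_def bij_betw_def by blast
  have ne: "\<forall>a. \<sigma> a \<noteq> []"
    using assms(4) unfolding associated_substitution_def by blast
  obtain V :: "nat \<Rightarrow> 'a \<Rightarrow> real" and B C :: real and N :: nat where V: "C > 0"
    "\<And>n a. N \<le> n \<Longrightarrow> prefix_weight \<gamma> ((subst_word \<sigma> ^^ n) [a]) \<le> C * exp (- V n a)"
    "\<And>n a. \<exists>m<length ((subst_word \<sigma> ^^ n) [a]).
      Re (word_value \<gamma> (take m ((subst_word \<sigma> ^^ n) [a]))) \<le> V n a + B"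
    using renormalised_sums[OF assms(6) ne assms(9,10)] by metis
  show False
    by (rule no_conjugate_of_bounded_sums[OF assms(1-4) V f conj inj])
qed

end
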